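(* Let $(\mathfrak g,\varphi,\xi,\eta)$ be an almost contact Lie algebra with abelian structure such that $\xi\in\mathfrak z(\mathfrak g)$, the center of $\mathfrak g$. Then $\mathfrak h=\operatorname{Ker}\eta$ admits a Lie algebra structure and an abelian complex structure given by $J=\varphi|_{\mathfrak h}$, such that $\mathfrak g$ is the $1$-dimensional central extension of $\mathfrak h$ by a $J$-invariant $2$-cocycle $\sigma$. Moreover, the cocycle $\sigma$ is given by $\sigma(X,Y)=-d\eta(X,Y)$, $X,Y\in\mathfrak h$. Conversely, if $\mathfrak h$ is a Lie algebra equipped with an abelian complex structure $J$ and $\sigma$ is a $J$-invariant $2$-cocycle on $\mathfrak h$, then the central extension $\mathfrak g=\mathbb R\xi\oplus_\sigma\mathfrak h$ carries a natural abelian almost contact structure $(\varphi,\xi,\eta)$. Moreover, $\eta$ is a contact form if and only if $\sigma$ is of maximal rank.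
   Context: An almost contact Lie algebra is a real Lie algebra $\mathfrak g$ of dimension $2n+1$ with $(\varphi,\xi,\eta)$, $\varphi\in\mathrm{End}(\mathfrak g)$, $\xi\in\mathfrak g$, $\eta\in\mathfrak g^*$, such that $\varphi^2=-I+\eta\otimes\xi$ and $\eta(\xi)=1$ (hence $\varphi\xi=0$, $\eta\circ\varphi=0$). The structure is abelian if $\mathrm{ad}_\xi\circ\varphi=\varphi\circ\mathrm{ad}_\xi$ and $[\varphi X,\varphi Y]=[X,Y]$ for all $X,Y\in\operatorname{Ker}\eta$. An abelian complex structure on a real Lie algebra $\mathfrak h$ is $J\in\mathrm{End}(\mathfrak h)$ with $J^2=-I$ and $[JX,JY]=[X,Y]$ for all $X,Y\in\mathfrak h$. A $2$-cocycle $\sigma$ on $\mathfrak h$ is a closed $2$-form, i.e. $\sigma([X,Y],Z)+\sigma([Y,Z],X)+\sigma([Z,X],Y)=0$ for all $X,Y,Z\in\mathfrak h$; it is $J$-invariant if $\sigma(JX,JY)=\sigma(X,Y)$. The central extension $\mathbb R\xi\oplus_\sigma\mathfrak h$ is the vector space $\mathbb R\xi\oplus\mathfrak h$ with bracket $[X,Y]'=\sigma(X,Y)\xi+[X,Y]$ for $X,Y\in\mathfrak h$ and $\xi$ central. Convention: $d\eta(X,Y)=-\eta([X,Y])$. The form $\eta$ is a contact form if $\eta\wedge(d\eta)^n\neq0$, where $\dim\mathfrak g=2n+1$; $\sigma$ is of maximal rank if it is non-degenerate on $\mathfrak h$. *)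

theory Defs
  imports "HOL-Analysis.Analysis" "HOL-Combinatorics.Permutations"
begin

text \<open>
  Vector spaces are linear subspaces \<open>V\<close> of an ambient real vector space type, since both a Lie
  algebra and the kernel of a linear form on it have to be considered. Maps are total functions of
  which only the values on \<open>V\<close> matter.
\<close>

definition linear_on_space ::
  "'a::real_vector set \<Rightarrow> 'b::real_vector set \<Rightarrow> ('a \<Rightarrow> 'b) \<Rightarrow> bool" where
  "linear_on_space V W f \<longleftrightarrow>
     (\<forall>X\<in>V. f X \<in> W) \<and>
     (\<forall>X\<in>V. \<forall>Y\<in>V. f (X + Y) = f X + f Y) \<and>
     (\<forall>c. \<forall>X\<in>V. f (c *\<^sub>R X) = c *\<^sub>R f X)"

definition alternating_bilinear_on ::
  "'a::real_vector set \<Rightarrow> 'b::real_vector set \<Rightarrow> ('a \<Rightarrow> 'a \<Rightarrow> 'b) \<Rightarrow> bool" where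
  "alternating_bilinear_on V W b \<longleftrightarrow>
     (\<forall>X\<in>V. linear_on_space V W (b X)) \<and>
     (\<forall>Y\<in>V. linear_on_space V W (\<lambda>X. b X Y)) \<and>
     (\<forall>X\<in>V. b X X = 0)"

text \<open>
  All Lie algebras are finite-dimensional. This is required explicitly because \<^const>\<open>dim\<close> is
  \<open>0\<close> for infinite-dimensional spaces.
\<close>

definition lie_algebra_on :: "'a::real_vector set \<Rightarrow> ('a \<Rightarrow> 'a \<Rightarrow> 'a) \<Rightarrow> bool" where
  "lie_algebra_on V br \<longleftrightarrow>
     subspace V \<and> (\<exists>B. finite B \<and> V \<subseteq> span B) \<and>
     alternating_bilinear_on V V br \<and>
     (\<forall>X\<in>V. \<forall>Y\<in>V. \<forall>Z\<in>V. br X (br Y Z) + br Y (br Z X) + br Z (br X Y) = 0)"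

definition lie_center :: "'a::real_vector set \<Rightarrow> ('a \<Rightarrow> 'a \<Rightarrow> 'a) \<Rightarrow> 'a set" where
  "lie_center V br = {X\<in>V. \<forall>Y\<in>V. br X Y = 0}"

definition lie_isomorphism ::
  "'a::real_vector set \<Rightarrow> ('a \<Rightarrow> 'a \<Rightarrow> 'a) \<Rightarrow> 'b::real_vector set \<Rightarrow> ('b \<Rightarrow> 'b \<Rightarrow> 'b) \<Rightarrow>
     ('a \<Rightarrow> 'b) \<Rightarrow> bool" where
  "lie_isomorphism V br W br' f \<longleftrightarrow>
     linear_on_space V W f \<and> bij_betw f V W \<and>
     (\<forall>X\<in>V. \<forall>Y\<in>V. f (br X Y) = br' (f X) (f Y))"

definition abelian_complex_structure ::
  "'a::real_vector set \<Rightarrow> ('a \<Rightarrow> 'a \<Rightarrow> 'a) \<Rightarrow> ('a \<Rightarrow> 'a) \<Rightarrow> bool" where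
  "abelian_complex_structure V br J \<longleftrightarrow>
     linear_on_space V V J \<and>
     (\<forall>X\<in>V. J (J X) = - X) \<and>
     (\<forall>X\<in>V. \<forall>Y\<in>V. br (J X) (J Y) = br X Y)"

definition two_cocycle_on ::
  "'a::real_vector set \<Rightarrow> ('a \<Rightarrow> 'a \<Rightarrow> 'a) \<Rightarrow> ('a \<Rightarrow> 'a \<Rightarrow> real) \<Rightarrow> bool" where
  "two_cocycle_on V br \<sigma> \<longleftrightarrow>
     alternating_bilinear_on V UNIV \<sigma> \<and>
     (\<forall>X\<in>V. \<forall>Y\<in>V. \<forall>Z\<in>V. \<sigma> (br X Y) Z + \<sigma> (br Y Z) X + \<sigma> (br Z X) Y = 0)"

definition invariant_form_on ::
  "'a::real_vector set \<Rightarrow> ('a \<Rightarrow> 'a) \<Rightarrow> ('a \<Rightarrow> 'a \<Rightarrow> real) \<Rightarrow> bool" where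
  "invariant_form_on V J \<sigma> \<longleftrightarrow> (\<forall>X\<in>V. \<forall>Y\<in>V. \<sigma> (J X) (J Y) = \<sigma> X Y)"

definition maximal_rank_on :: "'a::real_vector set \<Rightarrow> ('a \<Rightarrow> 'a \<Rightarrow> real) \<Rightarrow> bool" where
  "maximal_rank_on V \<sigma> \<longleftrightarrow> (\<forall>X\<in>V. (\<forall>Y\<in>V. \<sigma> X Y = 0) \<longrightarrow> X = 0)"

text \<open>
  The space \<open>\<real>\<xi> \<oplus> V\<close> is realised as the product \<open>\<real> \<times> V\<close>, with \<open>(t, X)\<close> standing for
  \<open>t \<xi> + X\<close>; in particular \<open>\<xi>\<close> is \<open>(1, 0)\<close>.
\<close>

definition central_extension :: "'a::real_vector set \<Rightarrow> (real \<times> 'a) set" where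
  "central_extension V = UNIV \<times> V"

definition central_extension_bracket ::
  "('a \<Rightarrow> 'a \<Rightarrow> real) \<Rightarrow> ('a \<Rightarrow> 'a \<Rightarrow> 'a) \<Rightarrow> real \<times> 'a \<Rightarrow> real \<times> 'a \<Rightarrow> real \<times> 'a" where
  "central_extension_bracket \<sigma> br x y = (\<sigma> (snd x) (snd y), br (snd x) (snd y))"

text \<open>
  A Lie algebra \<open>g\<close> containing \<open>h\<close> as a subspace (not as a subalgebra) is the central extension
  of \<open>h\<close> by \<open>\<sigma>\<close> with central vector \<open>\<xi>\<close> if the canonical map is an isomorphism.
\<close>

definition is_central_extension ::
  "'a::real_vector set \<Rightarrow> ('a \<Rightarrow> 'a \<Rightarrow> 'a) \<Rightarrow> 'a \<Rightarrow> 'a set \<Rightarrow> ('a \<Rightarrow> 'a \<Rightarrow> 'a) \<Rightarrow>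
     ('a \<Rightarrow> 'a \<Rightarrow> real) \<Rightarrow> bool" where
  "is_central_extension g brg \<xi> h brh \<sigma> \<longleftrightarrow>
     lie_isomorphism (central_extension h) (central_extension_bracket \<sigma> brh) g brg
       (\<lambda>(t, X). t *\<^sub>R \<xi> + X)"

definition form_kernel :: "'a::real_vector set \<Rightarrow> ('a \<Rightarrow> real) \<Rightarrow> 'a set" where
  "form_kernel V \<eta> = {X\<in>V. \<eta> X = 0}"

definition almost_contact_lie_algebra ::
  "'a::real_vector set \<Rightarrow> ('a \<Rightarrow> 'a \<Rightarrow> 'a) \<Rightarrow> ('a \<Rightarrow> 'a) \<Rightarrow> 'a \<Rightarrow> ('a \<Rightarrow> real) \<Rightarrow> bool" where
  "almost_contact_lie_algebra V br \<phi> \<xi> \<eta> \<longleftrightarrow>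
     lie_algebra_on V br \<and> (\<exists>n. dim V = 2 * n + 1) \<and>
     linear_on_space V V \<phi> \<and> \<xi> \<in> V \<and> linear_on_space V UNIV \<eta> \<and>
     (\<forall>X\<in>V. \<phi> (\<phi> X) = - X + \<eta> X *\<^sub>R \<xi>) \<and> \<eta> \<xi> = 1"

definition abelian_almost_contact ::
  "'a::real_vector set \<Rightarrow> ('a \<Rightarrow> 'a \<Rightarrow> 'a) \<Rightarrow> ('a \<Rightarrow> 'a) \<Rightarrow> 'a \<Rightarrow> ('a \<Rightarrow> real) \<Rightarrow> bool" where
  "abelian_almost_contact V br \<phi> \<xi> \<eta> \<longleftrightarrow>
     almost_contact_lie_algebra V br \<phi> \<xi> \<eta> \<and>
     (\<forall>X\<in>V. br \<xi> (\<phi> X) = \<phi> (br \<xi> X)) \<and>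
     (\<forall>X\<in>form_kernel V \<eta>. \<forall>Y\<in>form_kernel V \<eta>. br (\<phi> X) (\<phi> Y) = br X Y)"

definition ext_d :: "('a \<Rightarrow> 'a \<Rightarrow> 'a) \<Rightarrow> ('a \<Rightarrow> real) \<Rightarrow> 'a \<Rightarrow> 'a \<Rightarrow> real" where
  "ext_d br \<eta> X Y = - \<eta> (br X Y)"

text \<open>
  A \<open>k\<close>-form is a function of a sequence of vectors \<open>v\<close> that depends only on \<open>v 0, \<dots>, v (k - 1)\<close>.
  The wedge product of a \<open>p\<close>-form and a \<open>q\<close>-form is normalised by \<open>1 / (p! q!)\<close>, in accordance
  with the convention \<open>d\<eta>(X, Y) = - \<eta>([X, Y])\<close>.
\<close>

definition wedge ::
  "nat \<Rightarrow> nat \<Rightarrow> ((nat \<Rightarrow> 'a) \<Rightarrow> real) \<Rightarrow> ((nat \<Rightarrow> 'a) \<Rightarrow> real) \<Rightarrow> (nat \<Rightarrow> 'a) \<Rightarrow> real" where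
  "wedge p q \<alpha> \<beta> v =
     (\<Sum>\<pi> | \<pi> permutes {..<p + q}.
        of_int (sign \<pi>) * \<alpha> (\<lambda>i. v (\<pi> i)) * \<beta> (\<lambda>i. v (\<pi> (p + i)))) / (fact p * fact q)"

definition one_form :: "('a \<Rightarrow> real) \<Rightarrow> (nat \<Rightarrow> 'a) \<Rightarrow> real" where
  "one_form \<eta> v = \<eta> (v 0)"

definition two_form :: "('a \<Rightarrow> 'a \<Rightarrow> real) \<Rightarrow> (nat \<Rightarrow> 'a) \<Rightarrow> real" where
  "two_form \<omega> v = \<omega> (v 0) (v 1)"

fun two_form_power :: "('a \<Rightarrow> 'a \<Rightarrow> real) \<Rightarrow> nat \<Rightarrow> (nat \<Rightarrow> 'a) \<Rightarrow> real" where
  "two_form_power \<omega> 0 = (\<lambda>v. 1)"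
| "two_form_power \<omega> (Suc n) = wedge 2 (2 * n) (two_form \<omega>) (two_form_power \<omega> n)"

definition contact_form ::
  "'a::real_vector set \<Rightarrow> ('a \<Rightarrow> 'a \<Rightarrow> 'a) \<Rightarrow> ('a \<Rightarrow> real) \<Rightarrow> bool" where
  "contact_form V br \<eta> \<longleftrightarrow>
     (\<exists>n. dim V = 2 * n + 1 \<and>
        (\<exists>v. (\<forall>i. v i \<in> V) \<and>
           wedge 1 (2 * n) (one_form \<eta>) (two_form_power (ext_d br \<eta>) n) v \<noteq> 0))"

definition ext_phi :: "('a::real_vector \<Rightarrow> 'a) \<Rightarrow> real \<times> 'a \<Rightarrow> real \<times> 'a" where
  "ext_phi J x = (0, J (snd x))"

definition ext_xi :: "real \<times> 'a::real_vector" where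
  "ext_xi = (1, 0)"

definition ext_eta :: "real \<times> 'a::real_vector \<Rightarrow> real" where
  "ext_eta x = fst x"

end

theory Submission
  imports Defs
begin

text \<open>
  The Lie-algebraic part is bookkeeping along \<open>g = \<real>\<xi> \<oplus> Ker \<eta>\<close>: the bracket on \<open>Ker \<eta>\<close> is the
  projection of the bracket of \<open>g\<close>, and the cocycle is its \<open>\<xi>\<close>-component; centrality of \<open>\<xi>\<close> makes
  the Jacobi identity of \<open>g\<close> split into Jacobi identity and cocycle condition.

  For the contact condition, \<open>\<eta> \<and> (d\<eta>)\<^sup>n\<close> is, up to the factor \<open>2\<^sup>n\<close>, the alternation of
  \<open>\<eta>(v 0) d\<eta>(v 1, v 2) \<cdots> d\<eta>(v (2n - 1), v (2n))\<close>. If the form is degenerate, it is killed by a nonzero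
  vector, so that this top-degree form vanishes. If it is non-degenerate, the top-degree form is
  evaluated on \<open>\<xi>\<close> followed by a symplectic basis, where every term of the alternating sum is
  non-negative.
\<close>

subsection \<open>Wedge products as alternations\<close>

text \<open>The unnormalised antisymmetrisation. Without a factor \<open>1 / m!\<close>, a wedge
  product is this operator applied to a tensor product and divided by \<open>p! q!\<close>.\<close>

definition alternation :: "nat \<Rightarrow> ((nat \<Rightarrow> 'a) \<Rightarrow> real) \<Rightarrow> (nat \<Rightarrow> 'a) \<Rightarrow> real" where
  "alternation m F v = (\<Sum>\<pi> | \<pi> permutes {..<m}. of_int (sign \<pi>) * F (\<lambda>i. v (\<pi> i)))"

lemma wedge_eq_alternation:
  "wedge p q \<alpha> \<beta> v = alternation (p + q) (\<lambda>w. \<alpha> w * \<beta> (\<lambda>i. w (p + i))) v / (fact p * fact q)"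
  by (simp add: wedge_def alternation_def mult.assoc)

lemma alternation_divide: "alternation m (\<lambda>w. F w / c) v = alternation m F v / c"
  by (simp add: alternation_def sum_divide_distrib)

text \<open>A permutation of the last \<open>q\<close> slots can be absorbed into the outer
  permutation of all \<open>p + q\<close> slots. It does not affect \<open>\<alpha>\<close>, which
  reads only the first \<open>p\<close> entries, and signs multiply, so each of the
  \<open>q!\<close> inner permutations contributes the same amount.\<close>

lemma alternation_nested:
  assumes \<alpha>: "\<And>v w. (\<And>i. i < p \<Longrightarrow> v i = w i) \<Longrightarrow> \<alpha> v = \<alpha> w"
  shows "alternation (p + q) (\<lambda>w. \<alpha> w * alternation q \<beta> (\<lambda>i. w (p + i))) v =
    fact q * alternation (p + q) (\<lambda>w. \<alpha> w * \<beta> (\<lambda>i. w (p + i))) v"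
proof -
  \<comment> \<open>\<open>lift \<rho>\<close> is \<open>\<rho>\<close> moved to the indices
    \<open>p, ..., p + q - 1\<close>; it fixes all others.\<close>
  define lift where "lift = map_permutation {..<q} ((+) p)"
  have inj: "inj_on ((+) p) {..<q}"
    by simp
  have lift_permutes: "lift \<rho> permutes {..<p + q}" if "\<rho> permutes {..<q}" for \<rho>
  proof -
    have "lift \<rho> permutes ((+) p) ` {..<q}"
      unfolding lift_def using that inj by (intro map_permutation_permutes) (auto simp: bij_betw_def)
    then show ?thesis
      by (rule permutes_subset) auto
  qed
  have lift_low: "lift \<rho> i = i" if "i < p" for \<rho> i
    using that by (auto simp: lift_def map_permutation_def restrict_id_def)
  have lift_high: "lift \<rho> (p + i) = p + \<rho> i" if "\<rho> permutes {..<q}" for \<rho> i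
  proof (cases "i < q")
    case True
    then show ?thesis
      using map_permutation_apply[OF inj, of i \<rho>] by (simp add: lift_def)
  next
    case False
    then have "\<rho> i = i"
      using that by (simp add: permutes_not_in)
    with False show ?thesis
      by (auto simp: lift_def map_permutation_def restrict_id_def)
  qed
  let ?t = "\<lambda>\<pi>. of_int (sign \<pi>) * (\<alpha> (\<lambda>i. v (\<pi> i)) * \<beta> (\<lambda>i. v (\<pi> (p + i))))"
  have lifted_term: "?t (\<pi> \<circ> lift \<rho>) = of_int (sign \<pi>) * (\<alpha> (\<lambda>i. v (\<pi> i)) *
      (of_int (sign \<rho>) * \<beta> (\<lambda>i. v (\<pi> (p + \<rho> i)))))"
    if "\<pi> permutes {..<p + q}" "\<rho> permutes {..<q}" for \<pi> \<rho>
  proof -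
    have "sign (lift \<rho>) = sign \<rho>"
      unfolding lift_def using that inj by (intro sign_map_permutation) auto
    then have "sign (\<pi> \<circ> lift \<rho>) = sign \<pi> * sign \<rho>"
      using that lift_permutes[OF that(2)]
      by (subst sign_compose) (auto intro: permutes_imp_permutation[OF finite_lessThan])
    moreover have "\<alpha> (\<lambda>i. v ((\<pi> \<circ> lift \<rho>) i)) = \<alpha> (\<lambda>i. v (\<pi> i))"
      by (rule \<alpha>) (simp add: lift_low)
    ultimately show ?thesis
      by (simp add: lift_high[OF that(2)])
  qed
  have "alternation (p + q) (\<lambda>w. \<alpha> w * alternation q \<beta> (\<lambda>i. w (p + i))) v =
      (\<Sum>\<pi> | \<pi> permutes {..<p + q}. \<Sum>\<rho> | \<rho> permutes {..<q}. ?t (\<pi> \<circ> lift \<rho>))"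
    unfolding alternation_def sum_distrib_left by (intro sum.cong refl lifted_term[symmetric]) auto
  also have "\<dots> = (\<Sum>\<rho> | \<rho> permutes {..<q}. \<Sum>\<pi> | \<pi> permutes {..<p + q}. ?t (\<pi> \<circ> lift \<rho>))"
    by (rule sum.swap)
  \<comment> \<open>Composition with a fixed \<open>lift \<rho>\<close> is a bijection of the range
    of \<open>\<pi>\<close>, so the inner sum no longer depends on \<open>\<rho>\<close>.\<close>
  also have "\<dots> = (\<Sum>\<rho> | \<rho> permutes {..<q}. \<Sum>\<pi> | \<pi> permutes {..<p + q}. ?t \<pi>)"
    by (intro sum.cong refl sum_permutations_compose_right[symmetric]) (simp add: lift_permutes)
  also have "\<dots> = fact q * alternation (p + q) (\<lambda>w. \<alpha> w * \<beta> (\<lambda>i. w (p + i))) v"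
    by (simp add: alternation_def card_permutations)
  finally show ?thesis .
qed

text \<open>The factor \<open>(2n)!\<close> produced by the nested alternation cancels the
  \<open>1 / (2n)!\<close> of the wedge product, so each wedge leaves only
  \<open>1 / 2!\<close>.\<close>

lemma two_form_power_eq_alternation:
  "two_form_power \<omega> n = (\<lambda>v. alternation (2 * n) (\<lambda>w. \<Prod>i<n. \<omega> (w (2 * i)) (w (2 * i + 1))) v / 2 ^ n)"
proof (induction n)
  case 0
  have "{\<pi>. \<pi> permutes {..<0::nat}} = {id}"
    by auto
  then show ?case
    by (simp add: alternation_def)
next
  case (Suc n)
  show ?case
  proof
    fix v
    have "two_form_power \<omega> (Suc n) v =
        alternation (2 + 2 * n) (\<lambda>w. two_form \<omega> w *
          alternation (2 * n) (\<lambda>w. \<Prod>i<n. \<omega> (w (2 * i)) (w (2 * i + 1))) (\<lambda>i. w (2 + i))) v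
        / 2 ^ n / (2 * fact (2 * n))"
      by (simp only: two_form_power.simps wedge_eq_alternation Suc.IH fact_2 times_divide_eq_right
          alternation_divide)
    also have "\<dots> = alternation (2 + 2 * n) (\<lambda>w. two_form \<omega> w *
          (\<Prod>i<n. \<omega> (w (2 + 2 * i)) (w (2 + (2 * i + 1))))) v / 2 ^ Suc n"
      by (subst alternation_nested) (simp_all add: two_form_def)
    \<comment> \<open>The new factor occupies slots 0 and 1 and moves the earlier pairs up by two,
      so it is the first factor of the longer product.\<close>
    also have "(\<lambda>w. two_form \<omega> w * (\<Prod>i<n. \<omega> (w (2 + 2 * i)) (w (2 + (2 * i + 1))))) =
        (\<lambda>w. \<Prod>i<Suc n. \<omega> (w (2 * i)) (w (2 * i + 1)))"
      by (simp only: prod.lessThan_Suc_shift two_form_def) simp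
    finally show "two_form_power \<omega> (Suc n) v =
        alternation (2 * Suc n) (\<lambda>w. \<Prod>i<Suc n. \<omega> (w (2 * i)) (w (2 * i + 1))) v / 2 ^ Suc n"
      by simp
  qed
qed

text \<open>The same cancellation once more, with \<open>\<eta>\<close> in slot 0. This moves the
  pairs to (1, 2), (3, 4), ..., the numbering used from here on.\<close>

lemma contact_volume_eq_alternation:
  "wedge 1 (2 * n) (one_form \<eta>) (two_form_power \<omega> n) v =
    alternation (1 + 2 * n) (\<lambda>w. \<eta> (w 0) * (\<Prod>i<n. \<omega> (w (2 * i + 1)) (w (2 * i + 2)))) v / 2 ^ n"
proof -
  have "wedge 1 (2 * n) (one_form \<eta>) (two_form_power \<omega> n) v =
      alternation (1 + 2 * n) (\<lambda>w. one_form \<eta> w *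
        alternation (2 * n) (\<lambda>w. \<Prod>i<n. \<omega> (w (2 * i)) (w (2 * i + 1))) (\<lambda>i. w (1 + i))) v
      / 2 ^ n / (1 * fact (2 * n))"
    by (simp only: wedge_eq_alternation two_form_power_eq_alternation fact_1 times_divide_eq_right
        alternation_divide)
  also have "\<dots> = alternation (1 + 2 * n) (\<lambda>w. one_form \<eta> w *
      (\<Prod>i<n. \<omega> (w (1 + 2 * i)) (w (1 + (2 * i + 1))))) v / 2 ^ n"
    by (subst alternation_nested) (simp_all add: one_form_def)
  finally show ?thesis
    by (simp add: one_form_def)
qed

text \<open>Composing every permutation with the transposition of \<open>i\<close> and
  \<open>j\<close> flips all signs but leaves the arguments unchanged, so the sum equals its own
  negative.\<close>

lemma alternation_eq_0_if_repeated:
  assumes "i < m" "j < m" "i \<noteq> j" "v i = v j"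
  shows "alternation m F v = 0"
proof -
  let ?\<tau> = "Transposition.transpose i j"
  have \<tau>: "?\<tau> permutes {..<m}"
    using assms by (intro permutes_swap_id) auto
  have v: "v (?\<tau> k) = v k" for k
    using assms by (auto simp: Transposition.transpose_def)
  have "alternation m F v =
      (\<Sum>\<pi> | \<pi> permutes {..<m}. of_int (sign (?\<tau> \<circ> \<pi>)) * F (\<lambda>i. v ((?\<tau> \<circ> \<pi>) i)))"
    unfolding alternation_def by (rule setum_permutations_compose_left[OF \<tau>])
  also have "\<dots> = (\<Sum>\<pi> | \<pi> permutes {..<m}. - (of_int (sign \<pi>) * F (\<lambda>i. v (\<pi> i))))"
  proof (rule sum.cong)
    fix \<pi> assume "\<pi> \<in> {\<pi>. \<pi> permutes {..<m}}"
    then have "sign (?\<tau> \<circ> \<pi>) = - sign \<pi>"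
      using assms by (subst sign_compose)
        (auto simp: sign_swap_id permutation_swap_id intro: permutes_imp_permutation[OF finite_lessThan])
    then show "of_int (sign (?\<tau> \<circ> \<pi>)) * F (\<lambda>i. v ((?\<tau> \<circ> \<pi>) i)) = - (of_int (sign \<pi>) * F (\<lambda>i. v (\<pi> i)))"
      by (simp add: v)
  qed simp
  also have "\<dots> = - alternation m F v"
    by (simp add: alternation_def sum_negf)
  finally show ?thesis
    by simp
qed

subsection \<open>Evaluation on a symplectic basis\<close>

text \<open>The Gram matrix of a symplectic basis with conjugate pairs (1, 2), (3, 4), .... Indices
  start at 1 because slot 0 is kept for \<open>\<xi>\<close>.\<close>

definition standard_pairing :: "nat \<Rightarrow> nat \<Rightarrow> real" where
  "standard_pairing a b =
    (if odd a \<and> b = Suc a then 1 else if odd b \<and> a = Suc b then - 1 else 0)"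

text \<open>
  A nonzero term maps blocks \<open>{2i + 1, 2i + 2}\<close> to blocks. Swapping two blocks is even, and flipping
  one changes both signs, so the last block may be assumed fixed.
\<close>

lemma standard_pairing_nonneg_term:
  assumes "\<pi> permutes {1..2 * n}"
  shows "0 \<le> of_int (sign \<pi>) * (\<Prod>i<n. standard_pairing (\<pi> (2 * i + 1)) (\<pi> (2 * i + 2)))"
  using assms
proof (induction n arbitrary: \<pi>)
  case 0
  then show ?case by simp
next
  case (Suc n)
  let ?p = "\<lambda>\<pi> i. standard_pairing (\<pi> (2 * i + 1)) (\<pi> (2 * i + 2))"
  show ?case
  proof (cases "\<exists>i<Suc n. ?p \<pi> i = 0")
    case True
    then have "(\<Prod>i<Suc n. ?p \<pi> i) = 0"
      by (intro prod_zero) auto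
    then show ?thesis
      by (simp only: mult_zero_right order_refl)
  next
    case False
    \<comment> \<open>\<open>k\<close> is the block containing the preimage of
      \<open>2 * n + 1\<close>. Its factor is nonzero, so the other index of the block must go to
      the partner \<open>2 * n + 2\<close>.\<close>
    obtain a where a: "\<pi> a = 2 * n + 1"
      using permutes_surj[OF Suc.prems] by (metis surjD)
    have "a \<in> {1..2 * Suc n}"
      using permutes_in_image[OF Suc.prems, of a] a by simp
    define k where "k = (a - 1) div 2"
    have k: "k < Suc n" "a = 2 * k + 1 \<or> a = 2 * k + 2"
      using \<open>a \<in> _\<close> by (auto simp: k_def)
    have block: "\<pi> (2 * k + 1) = 2 * n + 1 \<and> \<pi> (2 * k + 2) = 2 * n + 2 \<or>
        \<pi> (2 * k + 1) = 2 * n + 2 \<and> \<pi> (2 * k + 2) = 2 * n + 1"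
      using False k a by (auto simp: standard_pairing_def split: if_splits)
    \<comment> \<open>\<open>?\<tau>\<close> exchanges block \<open>k\<close> with the last block.
      Being made of two transpositions, or trivial when \<open>k = n\<close>, it is even; on the
      product it only permutes the factors.\<close>
    let ?\<tau> = "Transposition.transpose (2 * k + 1) (2 * n + 1) \<circ>
        Transposition.transpose (2 * k + 2) (2 * n + 2)"
    define \<sigma> where "\<sigma> = \<pi> \<circ> ?\<tau>"
    have \<tau>: "?\<tau> permutes {1..2 * Suc n}"
      using k by (intro permutes_compose permutes_swap_id) auto
    have \<sigma>: "\<sigma> permutes {1..2 * Suc n}"
      unfolding \<sigma>_def by (rule permutes_compose[OF \<tau> Suc.prems])
    have "sign ?\<tau> = 1"
      by (subst sign_compose) (auto simp: sign_swap_id permutation_swap_id)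
    then have sign_\<sigma>: "sign \<sigma> = sign \<pi>"
      unfolding \<sigma>_def using \<tau> Suc.prems
      by (subst sign_compose) (auto intro: permutes_imp_permutation[OF finite_atLeastAtMost])
    have odd_\<tau>: "?\<tau> (2 * i + 1) = 2 * Transposition.transpose k n i + 1" for i
      by (auto simp: Transposition.transpose_def)
    have even_\<tau>: "?\<tau> (2 * i + 2) = 2 * Transposition.transpose k n i + 2" for i
      by (auto simp: Transposition.transpose_def)
    have "(\<Prod>i<Suc n. ?p \<pi> i) = (\<Prod>i<Suc n. (?p \<pi> \<circ> Transposition.transpose k n) i)"
      using k by (intro prod.permute permutes_swap_id) auto
    also have "\<dots> = (\<Prod>i<Suc n. ?p \<sigma> i)"
      unfolding \<sigma>_def o_apply[of \<pi>] odd_\<tau> even_\<tau> by simp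
    finally have prod_\<sigma>: "(\<Prod>i<Suc n. ?p \<pi> i) = (\<Prod>i<Suc n. ?p \<sigma> i)" .
    have last: "\<sigma> (2 * n + 1) = \<pi> (2 * k + 1)" "\<sigma> (2 * n + 2) = \<pi> (2 * k + 2)"
      unfolding \<sigma>_def o_apply[of \<pi>] odd_\<tau> even_\<tau> by simp_all
    have restrict: "\<rho> permutes {1..2 * n}"
      if "\<rho> permutes {1..2 * Suc n}" "\<rho> (2 * n + 1) = 2 * n + 1" "\<rho> (2 * n + 2) = 2 * n + 2" for \<rho>
    proof (rule permutes_superset[OF that(1)])
      fix x assume "x \<in> {1..2 * Suc n} - {1..2 * n}"
      then have "x = 2 * n + 1 \<or> x = 2 * n + 2" by auto
      then show "\<rho> x = x" using that by auto
    qed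
    have "0 \<le> of_int (sign \<sigma>) * (\<Prod>i<Suc n. ?p \<sigma> i)"
      using block
    proof
      assume *: "\<pi> (2 * k + 1) = 2 * n + 1 \<and> \<pi> (2 * k + 2) = 2 * n + 2"
      then have "\<sigma> permutes {1..2 * n}"
        using last by (intro restrict \<sigma>) auto
      from Suc.IH[OF this] show ?thesis
        using * last by (simp add: standard_pairing_def)
    next
      assume *: "\<pi> (2 * k + 1) = 2 * n + 2 \<and> \<pi> (2 * k + 2) = 2 * n + 1"
      define \<rho> where "\<rho> = \<sigma> \<circ> Transposition.transpose (2 * n + 1) (2 * n + 2)"
      have \<rho>: "\<rho> permutes {1..2 * Suc n}"
        unfolding \<rho>_def by (intro permutes_compose permutes_swap_id \<sigma>) auto
      have "\<rho> permutes {1..2 * n}"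
        using * last by (intro restrict \<rho>) (auto simp: \<rho>_def)
      note IH = Suc.IH[OF this]
      have "sign \<rho> = - sign \<sigma>"
        unfolding \<rho>_def using \<sigma>
        by (subst sign_compose)
          (auto simp: sign_swap_id permutation_swap_id intro: permutes_imp_permutation[OF finite_atLeastAtMost])
      moreover have "(\<Prod>i<n. ?p \<rho> i) = (\<Prod>i<n. ?p \<sigma> i)"
        by (intro prod.cong) (auto simp: \<rho>_def Transposition.transpose_def)
      ultimately show ?thesis
        using IH * last by (simp add: standard_pairing_def)
    qed
    then show ?thesis
      by (simp only: sign_\<sigma> prod_\<sigma>)
  qed
qed

text \<open>A permutation that moves 0 contributes nothing, since \<open>\<eta>\<close> vanishes on
  every \<open>v a\<close> with \<open>a \<ge> 1\<close> in range. The others permute the symplectic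
  basis and contribute non-negative terms, and the identity contributes 1.\<close>

lemma contact_volume_pos_on_standard_basis:
  assumes \<eta>0: "\<eta> (v 0) = 1" and \<eta>: "\<And>a. a \<in> {1..2 * n} \<Longrightarrow> \<eta> (v a) = 0"
    and \<omega>: "\<And>a b. a \<in> {1..2 * n} \<Longrightarrow> b \<in> {1..2 * n} \<Longrightarrow> \<omega> (v a) (v b) = standard_pairing a b"
  shows "0 < wedge 1 (2 * n) (one_form \<eta>) (two_form_power \<omega> n) v"
proof -
  let ?F = "\<lambda>w. \<eta> (w 0) * (\<Prod>i<n. \<omega> (w (2 * i + 1)) (w (2 * i + 2)))"
  let ?T = "\<lambda>\<pi>. of_int (sign \<pi>) * ?F (\<lambda>i. v (\<pi> i))"
  have "0 \<le> ?T \<pi>" if \<pi>: "\<pi> permutes {..<1 + 2 * n}" for \<pi>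
  proof (cases "\<pi> 0 = 0")
    case True
    then have \<pi>': "\<pi> permutes {1..2 * n}"
      by (intro permutes_superset[OF \<pi>]) (auto simp: not_less_eq_eq)
    have "\<omega> (v (\<pi> (2 * i + 1))) (v (\<pi> (2 * i + 2))) =
        standard_pairing (\<pi> (2 * i + 1)) (\<pi> (2 * i + 2))" if "i < n" for i
      using that permutes_in_image[OF \<pi>', of "2 * i + 1"] permutes_in_image[OF \<pi>', of "2 * i + 2"]
      by (intro \<omega>) auto
    then have "?T \<pi> = of_int (sign \<pi>) *
        (\<Prod>i<n. standard_pairing (\<pi> (2 * i + 1)) (\<pi> (2 * i + 2)))"
      using True \<eta>0 by simp
    then show ?thesis
      using standard_pairing_nonneg_term[OF \<pi>'] by simp
  next
    case False
    have "\<pi> 0 \<in> {..<1 + 2 * n}"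
      using permutes_in_image[OF \<pi>, of 0] by simp
    with False have "\<eta> (v (\<pi> 0)) = 0"
      by (intro \<eta>) auto
    then show ?thesis by simp
  qed
  moreover have "0 < ?T id"
    using \<eta>0 by (simp add: \<omega> standard_pairing_def)
  ultimately have "0 < alternation (1 + 2 * n) ?F v"
    unfolding alternation_def
    by (intro sum_pos2[of _ id]) (auto simp: permutes_id finite_permutations)
  then show ?thesis
    by (simp only: contact_volume_eq_alternation) simp
qed

subsection \<open>Existence of symplectic bases\<close>

lemma linear_on_space_zero:
  assumes "linear_on_space V W f" "0 \<in> V" shows "f 0 = 0"
proof -
  have "f (0 *\<^sub>R 0) = 0 *\<^sub>R f 0"
    using assms unfolding linear_on_space_def by blast
  then show ?thesis by simp
qed

text \<open>Besides kernels, this handles preimages of spans: a map that sends a set into a span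
  sends its span there as well.\<close>

lemma subspace_linear_on_space_preimage:
  assumes f: "linear_on_space V W f" and V: "subspace V" and T: "subspace T"
  shows "subspace {x\<in>V. f x \<in> T}"
proof (rule subspaceI)
  show "0 \<in> {x\<in>V. f x \<in> T}"
    using V T by (simp add: linear_on_space_zero[OF f] subspace_0)
next
  fix x y assume "x \<in> {x\<in>V. f x \<in> T}" "y \<in> {x\<in>V. f x \<in> T}"
  then show "x + y \<in> {x\<in>V. f x \<in> T}"
    using f V T by (simp add: linear_on_space_def subspace_add)
next
  fix c x assume "x \<in> {x\<in>V. f x \<in> T}"
  then show "c *\<^sub>R x \<in> {x\<in>V. f x \<in> T}"
    using f V T by (simp add: linear_on_space_def subspace_scale)
qed

lemma subspace_linear_on_space_kernel:
  assumes "linear_on_space V W f" "subspace V"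
  shows "subspace {x\<in>V. f x = 0}"
  using subspace_linear_on_space_preimage[OF assms subspace_single_0] by simp

lemma linear_on_space_diff:
  assumes "linear_on_space V W f" "subspace V" "x \<in> V" "y \<in> V"
  shows "f (x - y) = f x - f y"
proof -
  have "f (x - y) = f (x + (-1) *\<^sub>R y)" by simp
  also have "\<dots> = f x + (-1) *\<^sub>R f y"
    using assms subspace_scale[of V y "-1"] unfolding linear_on_space_def by metis
  finally show ?thesis by simp
qed

lemma linear_on_space_sum:
  assumes f: "linear_on_space V W f" and V: "subspace V" and x: "\<And>i. i \<in> I \<Longrightarrow> x i \<in> V"
  shows "f (\<Sum>i\<in>I. x i) = (\<Sum>i\<in>I. f (x i))"
  using x
proof (induction I rule: infinite_finite_induct)
  case (insert i I)
  then have "x i \<in> V" "(\<Sum>j\<in>I. x j) \<in> V"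
    using V by (auto intro: subspace_sum)
  then show ?case
    using f insert unfolding linear_on_space_def by simp
qed (simp_all add: linear_on_space_zero[OF f subspace_0[OF V]])

lemma alternating_bilinear_on_skew:
  assumes "alternating_bilinear_on V W b" "subspace V" "x \<in> V" "y \<in> V"
  shows "b x y = - b y x"
proof -
  have xy: "x + y \<in> V"
    using assms by (simp add: subspace_add)
  then have "b (x + y) (x + y) = b x x + b x y + (b y x + b y y)"
    using assms unfolding alternating_bilinear_on_def linear_on_space_def by metis
  then show ?thesis
    using assms xy unfolding alternating_bilinear_on_def by (simp add: add_eq_0_iff)
qed

text \<open>The symplectic Gram-Schmidt step: subtracting the expansion of \<open>y\<close> in the
  given pairs makes it orthogonal to all of them.\<close>

lemma symplectic_projection:
  fixes \<omega> :: "'a::real_vector \<Rightarrow> 'a \<Rightarrow> real"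
  assumes V: "subspace V" and \<omega>: "alternating_bilinear_on V UNIV \<omega>"
    and v: "\<And>a. v a \<in> V"
    and std: "\<And>a b. a \<in> {1..2 * k} \<Longrightarrow> b \<in> {1..2 * k} \<Longrightarrow> \<omega> (v a) (v b) = standard_pairing a b"
    and y: "y \<in> V"
  obtains s where "s \<in> span (v ` {1..2 * k})" "s \<in> V" "\<And>a. a \<in> {1..2 * k} \<Longrightarrow> \<omega> (y - s) (v a) = 0"
proof -
  \<comment> \<open>For a pair (e, f) with \<open>\<omega>\<close> value 1, the coefficient of e is
    the pairing of \<open>y\<close> with f, and the coefficient of f is minus the pairing of
    \<open>y\<close> with e.\<close>
  define s where "s = (\<Sum>i<k. \<omega> y (v (2 * i + 2)) *\<^sub>R v (2 * i + 1) - \<omega> y (v (2 * i + 1)) *\<^sub>R v (2 * i + 2))"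
  have summand: "\<omega> y (v (2 * i + 2)) *\<^sub>R v (2 * i + 1) - \<omega> y (v (2 * i + 1)) *\<^sub>R v (2 * i + 2) \<in> V" for i
    using V v by (simp add: subspace_diff subspace_scale)
  have sV: "s \<in> V"
    unfolding s_def using V summand by (intro subspace_sum) auto
  have "s \<in> span (v ` {1..2 * k})"
    unfolding s_def by (intro span_sum span_diff span_scale span_base) auto
  moreover have "\<omega> (y - s) (v a) = 0" if a: "a \<in> {1..2 * k}" for a
  proof -
    have lin: "linear_on_space V UNIV (\<lambda>x. \<omega> x (v a))"
      using \<omega> v by (simp add: alternating_bilinear_on_def)
    have scale: "\<omega> (c *\<^sub>R v b) (v a) = c * \<omega> (v b) (v a)" for c b
      using lin v by (simp add: linear_on_space_def)
    have "\<omega> s (v a) = (\<Sum>i<k. \<omega> (\<omega> y (v (2 * i + 2)) *\<^sub>R v (2 * i + 1) - \<omega> y (v (2 * i + 1)) *\<^sub>R v (2 * i + 2)) (v a))"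
      unfolding s_def by (rule linear_on_space_sum[OF lin V summand])
    also have "\<dots> = (\<Sum>i<k. \<omega> y (v (2 * i + 2)) * standard_pairing (2 * i + 1) a
        - \<omega> y (v (2 * i + 1)) * standard_pairing (2 * i + 2) a)"
      using V v a
      by (intro sum.cong refl, subst linear_on_space_diff[OF lin V])
        (auto simp: subspace_scale scale std)
    also have "\<dots> = \<omega> y (v a)"
    \<comment> \<open>Only the pair containing \<open>a\<close> survives in the sum. An even
      \<open>a\<close> is the second member of its pair and picks the first coefficient; an odd
      \<open>a\<close> picks the second. Pairs are counted from 0, whence
      \<open>a = 2 * j + 2\<close> or \<open>a = 2 * j + 1\<close>.\<close>
    proof (cases "even a")
      case True
      define j where "j = a div 2 - 1"
      have j: "a = 2 * j + 2" "j < k"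
        using True a by (auto simp: j_def)
      have "(\<Sum>i<k. \<omega> y (v (2 * i + 2)) * standard_pairing (2 * i + 1) a
          - \<omega> y (v (2 * i + 1)) * standard_pairing (2 * i + 2) a) =
          (\<Sum>i<k. if i = j then \<omega> y (v (2 * i + 2)) else 0)"
        by (intro sum.cong) (auto simp: standard_pairing_def j)
      then show ?thesis using j by simp
    next
      case False
      then obtain j where j: "a = 2 * j + 1"
        by (elim oddE)
      then have "j < k"
        using a by auto
      have "(\<Sum>i<k. \<omega> y (v (2 * i + 2)) * standard_pairing (2 * i + 1) a
          - \<omega> y (v (2 * i + 1)) * standard_pairing (2 * i + 2) a) =
          (\<Sum>i<k. if i = j then \<omega> y (v (2 * i + 1)) else 0)"
        by (intro sum.cong) (auto simp: standard_pairing_def j)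
      then show ?thesis using j \<open>j < k\<close> by simp
    qed
    finally have "\<omega> s (v a) = \<omega> y (v a)" .
    then show ?thesis
      using linear_on_space_diff[OF lin V y sV] by simp
  qed
  ultimately show ?thesis
    using sV that by blast
qed

text \<open>
  The spanning hypothesis replaces \<open>dim V \<ge> 2n\<close>; it spares the proof that a symplectic sequence is
  linearly independent.
\<close>

lemma symplectic_sequence_exists:
  fixes \<omega> :: "'a::real_vector \<Rightarrow> 'a \<Rightarrow> real"
  assumes V: "subspace V" and \<omega>: "alternating_bilinear_on V UNIV \<omega>"
    and nondeg: "maximal_rank_on V \<omega>"
    and large: "\<And>k v. k < n \<Longrightarrow> \<not> V \<subseteq> span (v ` {1..2 * k})"
  shows "\<exists>v. (\<forall>a. v a \<in> V) \<and>
    (\<forall>a\<in>{1..2 * n}. \<forall>b\<in>{1..2 * n}. \<omega> (v a) (v b) = standard_pairing a b)"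
proof -
  have "\<exists>v. (\<forall>a. v a \<in> V) \<and>
      (\<forall>a\<in>{1..2 * k}. \<forall>b\<in>{1..2 * k}. \<omega> (v a) (v b) = standard_pairing a b)" if "k \<le> n" for k
    using that
  proof (induction k)
    case 0
    \<comment> \<open>Sequences are total, so even the empty symplectic sequence needs values in
      \<open>V\<close>.\<close>
    show ?case
      using subspace_0[OF V] by (intro exI[of _ "\<lambda>_. 0"]) auto
  next
    case (Suc k)
    obtain v where v: "\<And>a. v a \<in> V"
      and std: "\<And>a b. a \<in> {1..2 * k} \<Longrightarrow> b \<in> {1..2 * k} \<Longrightarrow> \<omega> (v a) (v b) = standard_pairing a b"
      using Suc.IH[OF Suc_leD[OF Suc.prems]] by blast
    note skew = alternating_bilinear_on_skew[OF \<omega> V]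
    obtain x where x: "x \<in> V" "x \<notin> span (v ` {1..2 * k})"
      using large[of k v] Suc.prems by auto
    obtain s where s: "s \<in> span (v ` {1..2 * k})" "s \<in> V"
      "\<And>a. a \<in> {1..2 * k} \<Longrightarrow> \<omega> (x - s) (v a) = 0"
      using symplectic_projection[OF V \<omega> v std x(1)] by blast
    \<comment> \<open>\<open>e\<close> is nonzero because \<open>s\<close> lies in the span and
      \<open>x\<close> does not; non-degeneracy then supplies a \<open>y\<close> that pairs
      nontrivially with it.\<close>
    define e where "e = x - s"
    have e: "e \<in> V" "e \<noteq> 0" "\<And>a. a \<in> {1..2 * k} \<Longrightarrow> \<omega> e (v a) = 0"
      using V x s by (auto simp: e_def subspace_diff)
    then obtain y where y: "y \<in> V" "\<omega> e y \<noteq> 0"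
      using nondeg by (auto simp: maximal_rank_on_def)
    obtain t where t: "t \<in> span (v ` {1..2 * k})" "t \<in> V"
      "\<And>a. a \<in> {1..2 * k} \<Longrightarrow> \<omega> (y - t) (v a) = 0"
      using symplectic_projection[OF V \<omega> v std y(1)] by blast
    have lin: "linear_on_space V UNIV (\<omega> e)"
      using \<omega> e by (simp add: alternating_bilinear_on_def)
    \<comment> \<open>Since \<open>e\<close> is orthogonal to the whole span, correcting
      \<open>y\<close> by \<open>t\<close> does not change its pairing with \<open>e\<close>, and
      dividing by that pairing gives the partner \<open>f\<close>.\<close>
    have "span (v ` {1..2 * k}) \<subseteq> {z\<in>V. \<omega> e z = 0}"
      using v e(3) by (intro span_minimal subspace_linear_on_space_kernel[OF lin V]) auto
    then have "\<omega> e (y - t) = \<omega> e y"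
      using linear_on_space_diff[OF lin V y(1) t(2)] t(1) by auto
    define f where "f = (1 / \<omega> e y) *\<^sub>R (y - t)"
    have yt: "y - t \<in> V"
      using V y t by (simp add: subspace_diff)
    have f: "f \<in> V" "\<omega> e f = 1"
      using V yt lin y(2) \<open>\<omega> e (y - t) = _\<close>
      by (auto simp: f_def subspace_scale linear_on_space_def)
    have fv: "\<omega> f (v a) = 0" if "a \<in> {1..2 * k}" for a
      using \<omega> v[of a] yt t(3)[OF that] by (simp add: f_def alternating_bilinear_on_def linear_on_space_def)
    have diag: "\<omega> e e = 0" "\<omega> f f = 0" "\<omega> f e = - 1"
      using \<omega> e f skew[of f e] by (auto simp: alternating_bilinear_on_def)
    have ve: "\<omega> (v a) e = 0" "\<omega> (v a) f = 0" if "a \<in> {1..2 * k}" for a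
      using skew[OF v e(1)] skew[OF v f(1)] e(3)[OF that] fv[OF that] by auto
    define w where "w = v(2 * k + 1 := e, 2 * k + 2 := f)"
    have "\<omega> (w a) (w b) = standard_pairing a b"
      if "a \<in> {1..2 * Suc k}" "b \<in> {1..2 * Suc k}" for a b
    proof -
      have split: "c \<in> {1..2 * k} \<or> c = 2 * k + 1 \<or> c = 2 * k + 2" if "c \<in> {1..2 * Suc k}" for c
        using that by auto
      show ?thesis
        using split[OF that(1)] split[OF that(2)]
        by (elim disjE) (auto simp: w_def std e fv ve f diag standard_pairing_def)
    qed
    moreover have "w a \<in> V" for a
      using v e f by (simp add: w_def)
    ultimately show ?case by blast
  qed
  then show ?thesis by blast
qed

subsection \<open>Degenerate forms and dimensions\<close>

lemma finite_basis_of_subspace: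
  fixes V :: "'a::real_vector set"
  assumes "finite B" "V \<subseteq> span B"
  obtains S where "S \<subseteq> V" "independent S" "V \<subseteq> span S" "finite S" "card S = dim V"
proof -
  obtain S where S: "S \<subseteq> V" "independent S" "V \<subseteq> span S" "card S = dim V"
    using basis_exists[of V] by blast
  moreover have "finite S"
    using independent_span_bound[OF assms(1) S(2)] S(1) assms(2) by blast
  ultimately show ?thesis
    using that by blast
qed

lemma independent_subset_card_le_dim:
  fixes V :: "'a::real_vector set"
  assumes "finite B" "V \<subseteq> span B" "S \<subseteq> V" "independent S"
  shows "card S \<le> dim V"
proof -
  obtain S' where S': "S' \<subseteq> V" "independent S'" "V \<subseteq> span S'" "finite S'" "card S' = dim V"
    using finite_basis_of_subspace[OF assms(1,2)] .
  show ?thesis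
    using independent_span_bound[OF S'(4) assms(4) order_trans[OF assms(3) S'(3)]] S'(5) by simp
qed

text \<open>Otherwise \<open>x\<close>, \<open>v 0\<close>, \<open>v 1\<close>, ... could be added
  one at a time, each independent of the earlier ones, giving \<open>dim V + 1\<close> independent
  vectors in \<open>V\<close>.\<close>

lemma in_span_of_predecessors:
  fixes V :: "'a::real_vector set"
  assumes V: "finite B" "V \<subseteq> span B" and v: "\<And>i. v i \<in> V" and x: "x \<in> V" "x \<noteq> 0"
  shows "\<exists>j<dim V. v j \<in> span (insert x (v ` {..<j}))"
proof (rule ccontr)
  assume "\<not> ?thesis"
  then have none: "v j \<notin> span (insert x (v ` {..<j}))" if "j < dim V" for j
    using that by blast
  have "independent (insert x (v ` {..<k})) \<and> card (insert x (v ` {..<k})) = Suc k" if "k \<le> dim V" for k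
    using that
  proof (induction k)
    case 0
    show ?case
      using x by simp
  next
    case (Suc k)
    let ?S = "insert x (v ` {..<k})"
    have k: "v k \<notin> span ?S"
      by (rule none[OF Suc_le_lessD[OF Suc.prems]])
    have IH: "independent ?S" "card ?S = Suc k"
      using Suc.IH[OF Suc_leD[OF Suc.prems]] by simp_all
    have "insert x (v ` {..<Suc k}) = insert (v k) ?S"
      by (auto simp: lessThan_Suc)
    moreover have "card (insert (v k) ?S) = Suc (card ?S)"
      using k span_base[of "v k" ?S] by (intro card_insert_disjoint finite.insertI finite_imageI finite_lessThan) blast
    ultimately show ?case
      using independent_insertI[OF k IH(1)] IH(2) by (simp only: simp_thms)
  qed
  note max = this[OF order_refl]
  have "insert x (v ` {..<dim V}) \<subseteq> V"
    using v x(1) by blast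
  from independent_subset_card_le_dim[OF V this] max show False
    by linarith
qed

text \<open>Each slot occurs in exactly one factor: slot 0 in \<open>\<eta>\<close>, an odd slot as
  first and a positive even slot as second argument of one \<open>\<omega>\<close>. That factor is
  \<open>f\<close>, which kills \<open>x\<close>; the remaining factors form the constant
  \<open>c\<close>.\<close>

lemma contact_volume_slot_linear:
  fixes \<omega> :: "'a::real_vector \<Rightarrow> 'a \<Rightarrow> real"
  assumes \<omega>: "alternating_bilinear_on V UNIV \<omega>" and \<eta>: "linear_on_space V UNIV \<eta>"
    and w: "\<And>i. w i \<in> V" and k: "(k::nat) < 1 + 2 * n"
    and x: "\<eta> x = 0" "\<And>y. y \<in> V \<Longrightarrow> \<omega> x y = 0" "\<And>y. y \<in> V \<Longrightarrow> \<omega> y x = 0"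
  obtains f c where "linear_on_space V UNIV f" "f x = 0"
    "\<And>z. \<eta> ((w(k := z)) 0) * (\<Prod>i<n. \<omega> ((w(k := z)) (2 * i + 1)) ((w(k := z)) (2 * i + 2))) = f z * c"
proof -
  consider "k = 0" | l where "k = 2 * l + 1" "l < n" | l where "k = 2 * l + 2" "l < n"
  proof (cases "k = 0")
    case False
    define l where "l = (k - 1) div 2"
    have "k = 2 * l + 1 \<or> k = 2 * l + 2" "l < n"
      using False k by (auto simp: l_def)
    then show ?thesis
      using that(2,3) by blast
  qed (rule that(1))
  then show ?thesis
  proof cases
    case 1
    then show ?thesis
      by (intro that[of \<eta> "\<Prod>i<n. \<omega> (w (2 * i + 1)) (w (2 * i + 2))"]) (use \<eta> x in auto)
  next
    case (2 l)
    let ?c = "\<eta> (w 0) * (\<Prod>i\<in>{..<n} - {l}. \<omega> (w (2 * i + 1)) (w (2 * i + 2)))"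
    show ?thesis
    proof (rule that[of "\<lambda>z. \<omega> z (w (2 * l + 2))" ?c])
      fix z
      have "(\<Prod>i\<in>{..<n} - {l}. \<omega> ((w(k := z)) (2 * i + 1)) ((w(k := z)) (2 * i + 2))) =
          (\<Prod>i\<in>{..<n} - {l}. \<omega> (w (2 * i + 1)) (w (2 * i + 2)))"
        using 2 by (intro prod.cong) auto
      then show "\<eta> ((w(k := z)) 0) * (\<Prod>i<n. \<omega> ((w(k := z)) (2 * i + 1)) ((w(k := z)) (2 * i + 2))) =
          \<omega> z (w (2 * l + 2)) * ?c"
        using 2 by (subst prod.remove[of _ l]) auto
    qed (use \<omega> w x in \<open>auto simp: alternating_bilinear_on_def\<close>)
  next
    case (3 l)
    let ?c = "\<eta> (w 0) * (\<Prod>i\<in>{..<n} - {l}. \<omega> (w (2 * i + 1)) (w (2 * i + 2)))"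
    show ?thesis
    proof (rule that[of "\<omega> (w (2 * l + 1))" ?c])
      fix z
      have "2 * i + 1 \<noteq> 2 * l + 2" for i
        by presburger
      then have "(\<Prod>i\<in>{..<n} - {l}. \<omega> ((w(k := z)) (2 * i + 1)) ((w(k := z)) (2 * i + 2))) =
          (\<Prod>i\<in>{..<n} - {l}. \<omega> (w (2 * i + 1)) (w (2 * i + 2)))"
        using 3 by (intro prod.cong) auto
      then show "\<eta> ((w(k := z)) 0) * (\<Prod>i<n. \<omega> ((w(k := z)) (2 * i + 1)) ((w(k := z)) (2 * i + 2))) =
          \<omega> (w (2 * l + 1)) z * ?c"
        using 3 by (subst prod.remove[of _ l]) auto
    qed (use \<omega> w x in \<open>auto simp: alternating_bilinear_on_def\<close>)
  qed
qed

lemma linear_on_space_sum_fun: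
  fixes f :: "'i \<Rightarrow> 'a::real_vector \<Rightarrow> real"
  assumes "\<And>i. i \<in> I \<Longrightarrow> linear_on_space V UNIV (f i)"
  shows "linear_on_space V UNIV (\<lambda>x. \<Sum>i\<in>I. f i x)"
  using assms by (simp add: linear_on_space_def sum.distrib sum_distrib_left)

text \<open>View the volume as a linear function of one slot \<open>j\<close>. It vanishes at
  \<open>x\<close>, which kills every term, and at the earlier \<open>v i\<close>, which would be
  repeated. For a suitable \<open>j\<close> the vector \<open>v j\<close> is a combination of
  these.\<close>

lemma contact_volume_eq_0_if_degenerate:
  fixes \<omega> :: "'a::real_vector \<Rightarrow> 'a \<Rightarrow> real"
  assumes V: "subspace V" "finite B" "V \<subseteq> span B" and dim: "dim V = 2 * n + 1"
    and \<omega>: "alternating_bilinear_on V UNIV \<omega>" and \<eta>: "linear_on_space V UNIV \<eta>"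
    and v: "\<And>i. v i \<in> V"
    and x: "x \<in> V" "x \<noteq> 0" "\<eta> x = 0" "\<And>y. y \<in> V \<Longrightarrow> \<omega> x y = 0"
  shows "wedge 1 (2 * n) (one_form \<eta>) (two_form_power \<omega> n) v = 0"
proof -
  define F where "F w = \<eta> (w 0) * (\<Prod>i<n. \<omega> (w (2 * i + 1)) (w (2 * i + 2)))" for w
  have x': "\<omega> y x = 0" if "y \<in> V" for y
    using alternating_bilinear_on_skew[OF \<omega> V(1) that x(1)] x(4)[OF that] by simp
  \<comment> \<open>Here the top degree enters: the volume takes as many vectors as the dimension,
    so adding \<open>x\<close> to them forces a dependence.\<close>
  obtain j where j: "j < dim V" "v j \<in> span (insert x (v ` {..<j}))"
    using in_span_of_predecessors[of B V v x] V v x by blast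
  define G where "G z = alternation (1 + 2 * n) F (v(j := z))" for z
  have summand: "linear_on_space V UNIV (\<lambda>z. of_int (sign \<pi>) * F (\<lambda>i. (v(j := z)) (\<pi> i))) \<and>
      of_int (sign \<pi>) * F (\<lambda>i. (v(j := x)) (\<pi> i)) = 0"
    if \<pi>: "\<pi> permutes {..<1 + 2 * n}" for \<pi>
  proof -
    \<comment> \<open>Slot \<open>j\<close> of \<open>v\<close> becomes slot
      \<open>inv \<pi> j\<close> of the permuted sequence, so every summand is again a change of a
      single slot.\<close>
    have upd: "(\<lambda>i. (v(j := z)) (\<pi> i)) = (\<lambda>i. v (\<pi> i))(inv \<pi> j := z)" for z
      using permutes_inverses[OF \<pi>] by (auto simp: fun_eq_iff)
    have "inv \<pi> j < 1 + 2 * n"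
      using permutes_in_image[OF permutes_inv[OF \<pi>], of j] j dim by simp
    then obtain f c where f: "linear_on_space V UNIV f" "f x = 0"
      "\<And>z. F ((\<lambda>i. v (\<pi> i))(inv \<pi> j := z)) = f z * c"
      unfolding F_def
      using contact_volume_slot_linear[OF \<omega> \<eta>, of "\<lambda>i. v (\<pi> i)" "inv \<pi> j" n x] v x x' by blast
    show ?thesis
      unfolding upd f(3) using f(1,2) by (simp add: linear_on_space_def algebra_simps)
  qed
  have lin: "linear_on_space V UNIV G"
    unfolding G_def alternation_def using summand by (intro linear_on_space_sum_fun) blast
  have "G x = 0"
    unfolding G_def alternation_def using summand by (intro sum.neutral) blast
  moreover have "G (v i) = 0" if "i < j" for i
    unfolding G_def using that j dim by (intro alternation_eq_0_if_repeated[of i _ j]) auto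
  ultimately have "span (insert x (v ` {..<j})) \<subseteq> {z\<in>V. G z = 0}"
    using v x(1) by (intro span_minimal subspace_linear_on_space_kernel[OF lin V(1)]) auto
  then have "G (v j) = 0"
    using j by auto
  then show ?thesis
    unfolding contact_volume_eq_alternation G_def F_def fun_upd_triv by simp
qed

text \<open>In odd dimension an independent set of even size never spans. A set whose span is stable
  under \<open>J\<close> can therefore always be enlarged by some \<open>x\<close> and
  \<open>J x\<close>, and its size would exceed the dimension.\<close>

lemma complex_structure_even_dim:
  fixes V :: "'a::real_vector set"
  assumes V: "subspace V" "finite B" "V \<subseteq> span B"
    and J: "linear_on_space V V J" and JJ: "\<And>x. x \<in> V \<Longrightarrow> J (J x) = - x"
  shows "even (dim V)"
proof (rule ccontr)
  assume odd: "odd (dim V)"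
  have J_span: "J y \<in> span T" if "y \<in> span S" "S \<subseteq> V" "J ` S \<subseteq> span T" for y S T
  proof -
    have "span S \<subseteq> {y\<in>V. J y \<in> span T}"
      using that(2,3)
      by (intro span_minimal subspace_linear_on_space_preimage[OF J V(1) subspace_span]) auto
    then show ?thesis
      using that(1) by auto
  qed
  have "\<exists>S\<subseteq>V. finite S \<and> independent S \<and> card S = 2 * k \<and> J ` S \<subseteq> span S" for k
  proof (induction k)
    case 0
    show ?case
      by (intro exI[of _ "{}"]) (auto simp: independent_empty)
  next
    case (Suc k)
    then obtain S where S: "S \<subseteq> V" "finite S" "independent S" "card S = 2 * k" "J ` S \<subseteq> span S"
      by blast
    have "\<not> V \<subseteq> span S"
      using dim_unique[OF S(1) _ S(3,4)] odd by auto
    then obtain x where x: "x \<in> V" "x \<notin> span S"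
      by blast
    then have Jx: "J x \<in> V"
      using J by (simp add: linear_on_space_def)
    have "J x \<notin> span (insert x S)"
    proof
      assume "J x \<in> span (insert x S)"
      then obtain c where c: "J x - c *\<^sub>R x \<in> span S"
        by (auto simp: span_breakdown_eq)
      \<comment> \<open>Adding \<open>c\<close> times \<open>J x - c x\<close> to its image under
        \<open>J\<close> eliminates \<open>J x\<close> and leaves \<open>- (1 + c * c)\<close> times
        \<open>x\<close>: a real eigenvalue \<open>c\<close> of \<open>J\<close> modulo the span is
        impossible.\<close>
      have "J (J x - c *\<^sub>R x) = - x - c *\<^sub>R J x"
        using J JJ x Jx V(1) by (simp add: linear_on_space_diff[OF J] subspace_scale linear_on_space_def)
      then have "- x - c *\<^sub>R J x \<in> span S"
        using J_span[OF c S(1,5)] by simp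
      from span_add[OF this span_scale[OF c, of c]] have "(- (1 + c * c)) *\<^sub>R x \<in> span S"
        by (simp add: algebra_simps)
      from span_scale[OF this, of "inverse (- (1 + c * c))"]
      have "(inverse (- (1 + c * c)) * - (1 + c * c)) *\<^sub>R x \<in> span S"
        by (simp only: scaleR_scaleR)
      moreover have "- (1 + c * c) \<noteq> 0"
        using zero_le_square[of c] by linarith
      ultimately show False
        using x(2) by (simp only: left_inverse scaleR_one not_False_eq_True)
    qed
    moreover from this have "J x \<notin> insert x S" "x \<notin> S"
      using x by (auto intro: span_base)
    moreover have "J ` insert (J x) (insert x S) \<subseteq> span (insert (J x) (insert x S))"
    proof -
      have "J y \<in> span (insert (J x) (insert x S))" if "y \<in> S" for y
        using that S(5) span_mono[of S "insert (J x) (insert x S)"] by blast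
      then show ?thesis
        using x by (auto simp: JJ intro: span_base span_neg)
    qed
    ultimately show ?case
      using S x Jx
      by (intro exI[of _ "insert (J x) (insert x S)"]) (auto simp: independent_insertI)
  qed
  \<comment> \<open>The choice \<open>k = dim V\<close> suffices, because an odd dimension is
    positive and is exceeded by its double.\<close>
  from this[of "dim V"] obtain S where "S \<subseteq> V" "independent S" "card S = 2 * dim V"
    by blast
  then have "2 * dim V \<le> dim V"
    using independent_subset_card_le_dim[OF V(2,3)] by metis
  then show False
    using odd by simp
qed

text \<open>A basis of \<open>V\<close>, embedded with first component 0, together with
  \<open>(1, 0)\<close> is a basis of the extension; both claims are read off from it.\<close>

lemma
  fixes V :: "'a::real_vector set"
  assumes V: "subspace V" "finite B" "V \<subseteq> span B"
  shows central_extension_finite_span: "\<exists>B. finite B \<and> central_extension V \<subseteq> span B"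
    and dim_central_extension: "dim (central_extension V) = dim V + 1" (is ?dim)
proof -
  obtain S where S: "S \<subseteq> V" "independent S" "V \<subseteq> span S" "finite S" "card S = dim V"
    using finite_basis_of_subspace[OF V(2,3)] .
  let ?B = "insert (1 :: real, 0 :: 'a) (Pair 0 ` S)"
  have lin: "linear (Pair (0::real) :: 'a \<Rightarrow> _)"
    by (auto intro!: linearI)
  have span: "span (Pair (0::real) ` S) = Pair 0 ` span S"
    by (rule linear_span_image[OF lin])
  have "independent (Pair (0::real) ` S)"
    using S(2) by (intro linear_independent_injective_image lin) (auto simp: inj_on_def)
  moreover have new: "(1, 0) \<notin> span (Pair (0::real) ` S)"
    by (auto simp: span)
  ultimately have "independent ?B"
    by (simp add: independent_insertI)
  moreover have sub: "central_extension V \<subseteq> span ?B"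
  proof
    fix z assume "z \<in> central_extension V"
    then have "z - fst z *\<^sub>R (1, 0) \<in> span (Pair (0::real) ` S)"
      using S(3) by (cases z) (auto simp: span central_extension_def)
    then show "z \<in> span ?B"
      by (auto simp: span_breakdown_eq)
  qed
  moreover have "card ?B = dim V + 1"
    using S(4,5) by (subst card_insert_disjoint) (auto simp: card_image inj_on_def)
  moreover have "?B \<subseteq> central_extension V"
    using S(1) subspace_0[OF V(1)] by (auto simp: central_extension_def)
  ultimately show ?dim
    by (intro dim_unique)
  show "\<exists>B. finite B \<and> central_extension V \<subseteq> span B"
    by (rule exI[of _ ?B]) (simp add: sub S(4))
qed

subsection \<open>Contact forms and central extensions\<close>

text \<open>Centrality puts \<open>\<xi>\<close> in the radical of \<open>d\<eta>\<close>, so a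
  radical vector of the restriction to the kernel of \<open>\<eta>\<close> is radical on all of
  \<open>V\<close>. Formulated for any central \<open>\<xi>\<close> with
  \<open>\<eta> \<xi> = 1\<close>, so that both halves of the theorem can use it.\<close>

lemma contact_form_iff_maximal_rank:
  fixes V :: "'a::real_vector set"
  assumes lie: "lie_algebra_on V br" and dim: "dim V = 2 * n + 1"
    and \<eta>: "linear_on_space V UNIV \<eta>" and \<xi>: "\<xi> \<in> lie_center V br" "\<eta> \<xi> = 1"
  shows "contact_form V br \<eta> \<longleftrightarrow> maximal_rank_on (form_kernel V \<eta>) (\<lambda>X Y. \<eta> (br X Y))"
proof -
  let ?\<omega> = "ext_d br \<eta>" and ?h = "form_kernel V \<eta>"
  from lie obtain B where V: "subspace V" "finite B" "V \<subseteq> span B"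
    and br: "alternating_bilinear_on V V br"
    unfolding lie_algebra_on_def by (elim conjE exE)
  have \<xi>V: "\<xi> \<in> V" and \<xi>_br: "\<And>y. y \<in> V \<Longrightarrow> br \<xi> y = 0"
    using \<xi> by (auto simp: lie_center_def)
  have br_\<xi>: "br y \<xi> = 0" if "y \<in> V" for y
    using alternating_bilinear_on_skew[OF br V(1) that \<xi>V] \<xi>_br[OF that] by simp
  have \<eta>0: "\<eta> 0 = 0"
    by (rule linear_on_space_zero[OF \<eta> subspace_0[OF V(1)]])
  have hV: "?h \<subseteq> V" and h: "subspace ?h"
    using subspace_linear_on_space_kernel[OF \<eta> V(1)] by (auto simp: form_kernel_def)
  have split: "y - \<eta> y *\<^sub>R \<xi> \<in> ?h" if "y \<in> V" for y
    using that \<eta> \<xi> \<xi>V V(1)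
    by (simp add: form_kernel_def subspace_diff subspace_scale linear_on_space_diff[OF \<eta>] linear_on_space_def)
  have \<omega>: "alternating_bilinear_on V UNIV ?\<omega>"
    using br \<eta> \<eta>0 by (simp add: alternating_bilinear_on_def linear_on_space_def ext_d_def)
  have \<omega>h: "alternating_bilinear_on ?h UNIV ?\<omega>"
    using \<omega> hV[THEN subsetD] unfolding alternating_bilinear_on_def linear_on_space_def by simp
  \<comment> \<open>The sign in \<open>ext_d\<close> does not affect the radical.\<close>
  have rank: "maximal_rank_on ?h (\<lambda>X Y. \<eta> (br X Y)) \<longleftrightarrow> maximal_rank_on ?h ?\<omega>"
    by (simp add: maximal_rank_on_def ext_d_def)
  show ?thesis
    unfolding rank
  proof
    assume "contact_form V br \<eta>"
    then obtain m v where "dim V = 2 * m + 1" "\<And>i. v i \<in> V"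
      "wedge 1 (2 * m) (one_form \<eta>) (two_form_power ?\<omega> m) v \<noteq> 0"
      unfolding contact_form_def by (elim exE conjE) (rule, simp_all)
    moreover from this dim have "m = n" by simp
    ultimately have v: "\<And>i. v i \<in> V" "wedge 1 (2 * n) (one_form \<eta>) (two_form_power ?\<omega> n) v \<noteq> 0"
      by simp_all
    show "maximal_rank_on ?h ?\<omega>"
      unfolding maximal_rank_on_def
    proof (intro ballI impI)
      fix x assume x: "x \<in> ?h" and rad: "\<forall>y\<in>?h. ?\<omega> x y = 0"
      then have x': "x \<in> V" "\<eta> x = 0"
        by (auto simp: form_kernel_def)
      \<comment> \<open>Decompose \<open>y\<close> along \<open>\<xi>\<close> and the kernel:
        \<open>x\<close> pairs to zero with the kernel part by assumption and with
        \<open>\<xi>\<close> by centrality.\<close>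
      have "?\<omega> x y = 0" if y: "y \<in> V" for y
      proof -
        have lin: "linear_on_space V UNIV (?\<omega> x)"
          using \<omega> x' by (simp add: alternating_bilinear_on_def)
        have "?\<omega> x (y - \<eta> y *\<^sub>R \<xi>) = ?\<omega> x y - ?\<omega> x (\<eta> y *\<^sub>R \<xi>)"
          using y \<xi>V V(1) by (intro linear_on_space_diff[OF lin]) (auto simp: subspace_scale)
        also have "?\<omega> x (\<eta> y *\<^sub>R \<xi>) = \<eta> y * ?\<omega> x \<xi>"
          using lin \<xi>V by (simp add: linear_on_space_def)
        also have "?\<omega> x \<xi> = 0"
          by (simp add: ext_d_def br_\<xi>[OF x'(1)] \<eta>0)
        finally show ?thesis
          using rad split[OF y] by simp
      qed
      then show "x = 0"
        using contact_volume_eq_0_if_degenerate[where v = v, OF V dim \<omega> \<eta> v(1) x'(1) _ x'(2)] v(2) by blast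
    qed
  next
    assume nondeg: "maximal_rank_on ?h ?\<omega>"
    \<comment> \<open>Vectors spanning the kernel span \<open>V\<close> once \<open>\<xi>\<close> is
      added, so \<open>2 * k\<close> of them with \<open>k < n\<close> are too few for dimension
      \<open>2 * n + 1\<close>.\<close>
    have large: "\<not> ?h \<subseteq> span (v ` {1..2 * k})" if "k < n" for k and v :: "nat \<Rightarrow> 'a"
    proof
      assume sub: "?h \<subseteq> span (v ` {1..2 * k})"
      have "V \<subseteq> span (insert \<xi> (v ` {1..2 * k}))"
      proof
        fix y assume "y \<in> V"
        then have "y - \<eta> y *\<^sub>R \<xi> \<in> span (v ` {1..2 * k})"
          using split sub by blast
        then show "y \<in> span (insert \<xi> (v ` {1..2 * k}))"
          unfolding span_breakdown_eq by (rule exI)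
      qed
      then have "dim V \<le> card (insert \<xi> (v ` {1..2 * k}))"
        by (rule dim_le_card) simp
      also have "\<dots> \<le> Suc (card (v ` {1..2 * k}))"
        by (rule card_insert_le_m1) auto
      also have "card (v ` {1..2 * k}) \<le> 2 * k"
        using card_image_le[of "{1..2 * k}" v] by simp
      finally show False
        using dim that by simp
    qed
    obtain v where v: "\<And>a. v a \<in> ?h"
      "\<And>a b. a \<in> {1..2 * n} \<Longrightarrow> b \<in> {1..2 * n} \<Longrightarrow> ?\<omega> (v a) (v b) = standard_pairing a b"
      using symplectic_sequence_exists[OF h \<omega>h nondeg, of n, OF large] by blast
    \<comment> \<open>The symplectic sequence uses only the indices \<open>1, ..., 2n\<close>, so
      index 0 is free for \<open>\<xi>\<close>.\<close>
    have "0 < wedge 1 (2 * n) (one_form \<eta>) (two_form_power ?\<omega> n) (v(0 := \<xi>))"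
      using v \<xi>(2) by (intro contact_volume_pos_on_standard_basis) (auto simp: form_kernel_def)
    moreover have "(v(0 := \<xi>)) i \<in> V" for i
      using v(1) hV \<xi>V by auto
    ultimately show "contact_form V br \<eta>"
      unfolding contact_form_def
      by (intro exI[of _ n] exI[of _ "v(0 := \<xi>)"] conjI dim) (auto simp: less_le)
  qed
qed

section \<open>From an abelian structure with central \<open>\<xi>\<close> to a central
  extension\<close>

lemma abelian_almost_contact_kernel:
  fixes g :: "'a::real_vector set"
  assumes g: "abelian_almost_contact g br \<phi> \<xi> \<eta>" and center: "\<xi> \<in> lie_center g br"
  defines "h \<equiv> form_kernel g \<eta>"
    and "br' \<equiv> \<lambda>X Y. br X Y - \<eta> (br X Y) *\<^sub>R \<xi>"
    and "\<sigma> \<equiv> \<lambda>X Y. \<eta> (br X Y)"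
  shows "lie_algebra_on h br'" "abelian_complex_structure h br' \<phi>" "two_cocycle_on h br' \<sigma>"
    "invariant_form_on h \<phi> \<sigma>" "is_central_extension g br \<xi> h br' \<sigma>"
proof -
  have lie: "lie_algebra_on g br" and \<phi>: "linear_on_space g g \<phi>" and \<xi>: "\<xi> \<in> g"
    and \<eta>: "linear_on_space g UNIV \<eta>" and \<phi>\<phi>: "\<And>X. X \<in> g \<Longrightarrow> \<phi> (\<phi> X) = - X + \<eta> X *\<^sub>R \<xi>"
    and \<eta>\<xi>: "\<eta> \<xi> = 1"
    and abelian: "\<And>X Y. X \<in> h \<Longrightarrow> Y \<in> h \<Longrightarrow> br (\<phi> X) (\<phi> Y) = br X Y"
    using g unfolding abelian_almost_contact_def almost_contact_lie_algebra_def h_def by blast+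
  from lie obtain B where V: "subspace g" "finite B" "g \<subseteq> span B"
    and br: "alternating_bilinear_on g g br"
    and jacobi: "\<And>X Y Z. X \<in> g \<Longrightarrow> Y \<in> g \<Longrightarrow> Z \<in> g \<Longrightarrow> br X (br Y Z) + br Y (br Z X) + br Z (br X Y) = 0"
    unfolding lie_algebra_on_def by (elim conjE exE) (rule, simp_all)
  note lin = linear_on_space_def
  have br_in: "br X Y \<in> g" if "X \<in> g" "Y \<in> g" for X Y
    using br that by (simp add: alternating_bilinear_on_def lin)
  have br_lin: "linear_on_space g g (br X)" "linear_on_space g g (\<lambda>Y. br Y X)" if "X \<in> g" for X
    using br that by (simp_all add: alternating_bilinear_on_def)
  have \<xi>_br: "br \<xi> Y = 0" if "Y \<in> g" for Y
    using center that by (simp add: lie_center_def)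
  have br_\<xi>: "br Y \<xi> = 0" if "Y \<in> g" for Y
    using alternating_bilinear_on_skew[OF br V(1) that \<xi>] \<xi>_br[OF that] by simp
  have \<eta>0: "\<eta> 0 = 0" and \<phi>0: "\<phi> 0 = 0"
    using linear_on_space_zero[OF _ subspace_0[OF V(1)]] \<eta> \<phi> by auto
  have \<eta>_add: "\<eta> (X + Y) = \<eta> X + \<eta> Y" and \<eta>_scale: "\<eta> (c *\<^sub>R X) = c * \<eta> X"
    if "X \<in> g" "Y \<in> g" for X Y c
    using \<eta> that by (simp_all add: lin)
  have hg: "X \<in> g" "\<eta> X = 0" if "X \<in> h" for X
    using that by (simp_all add: h_def form_kernel_def)
  have h: "subspace h"
    using subspace_linear_on_space_kernel[OF \<eta> V(1)] by (simp add: h_def form_kernel_def)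
  have split: "X - \<eta> X *\<^sub>R \<xi> \<in> h" if "X \<in> g" for X
    using that \<eta>\<xi> \<xi> V(1)
    by (simp add: h_def form_kernel_def subspace_diff subspace_scale linear_on_space_diff[OF \<eta>] \<eta>_scale[OF _ \<xi>])
  have br'_in: "br' X Y \<in> h" if "X \<in> h" "Y \<in> h" for X Y
    unfolding br'_def using that by (intro split br_in hg)
  \<comment> \<open>\<open>br'\<close> differs from \<open>br\<close> by a multiple of the central
    \<open>\<xi>\<close>, which any further bracket kills. Iterated brackets of \<open>br'\<close>
    are thus projections of those of \<open>br\<close>.\<close>
  have br_br': "br X (br' Y Z) = br X (br Y Z)" "br (br' Y Z) X = br (br Y Z) X"
    if "X \<in> g" "Y \<in> g" "Z \<in> g" for X Y Z
  proof -
    note [simp] = br_in[OF that(2,3)] subspace_scale[OF V(1) \<xi>]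
    show "br X (br' Y Z) = br X (br Y Z)"
      using br_lin(1)[OF that(1)] \<xi> by (simp add: br'_def linear_on_space_diff[OF br_lin(1)[OF that(1)] V(1)] lin br_\<xi>[OF that(1)])
    show "br (br' Y Z) X = br (br Y Z) X"
      using br_lin(2)[OF that(1)] \<xi> by (simp add: br'_def linear_on_space_diff[OF br_lin(2)[OF that(1)] V(1)] lin \<xi>_br[OF that(1)])
  qed
  have br'_br': "br' X (br' Y Z) = br X (br Y Z) - \<eta> (br X (br Y Z)) *\<^sub>R \<xi>"
    if "X \<in> g" "Y \<in> g" "Z \<in> g" for X Y Z
    using br_br'(1)[OF that] by (simp add: br'_def)
  have br'_lin: "linear_on_space h h (br' X)" "linear_on_space h h (\<lambda>Y. br' Y X)" if "X \<in> h" for X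
    using that br'_in br_lin[OF hg(1)[OF that]]
    by (auto simp: lin br'_def hg br_in \<eta>_add \<eta>_scale[OF _ \<xi>] algebra_simps)
  have br_self: "br X X = 0" if "X \<in> g" for X
    using br that by (simp add: alternating_bilinear_on_def)
  show "lie_algebra_on h br'"
    unfolding lie_algebra_on_def
  proof (intro conjI ballI)
    show "\<exists>B. finite B \<and> h \<subseteq> span B"
      using V hg(1) by (intro exI[of _ B]) auto
    show "alternating_bilinear_on h h br'"
      using br'_lin by (simp add: alternating_bilinear_on_def br'_def br_self hg \<eta>0)
    fix X Y Z assume "X \<in> h" "Y \<in> h" "Z \<in> h"
    note g = this[THEN hg(1)]
    have in_g: "br X (br Y Z) \<in> g" "br Y (br Z X) \<in> g" "br Z (br X Y) \<in> g"
      using g by (simp_all add: br_in)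
    have "br' X (br' Y Z) + br' Y (br' Z X) + br' Z (br' X Y) =
        (br X (br Y Z) + br Y (br Z X) + br Z (br X Y))
        - \<eta> (br X (br Y Z) + br Y (br Z X) + br Z (br X Y)) *\<^sub>R \<xi>"
      using g in_g V(1) by (simp add: br'_br' \<eta>_add subspace_add algebra_simps)
    then show "br' X (br' Y Z) + br' Y (br' Z X) + br' Z (br' X Y) = 0"
      using jacobi[OF g] \<eta>0 by simp
  qed (rule h)
  have \<phi>h: "\<phi> X \<in> h" if "X \<in> h" for X
  proof -
    note X = hg[OF that]
    have \<phi>X: "\<phi> X \<in> g"
      using \<phi> X by (simp add: lin)
    \<comment> \<open>The cube of \<open>\<phi>\<close> at \<open>X\<close> is computed in two ways:
      from \<open>\<phi> (\<phi> X) = - X\<close>, and from the structure equation at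
      \<open>\<phi> X\<close>, whose extra term \<open>\<eta> (\<phi> X)\<close> times
      \<open>\<xi>\<close> must vanish.\<close>
    have "\<phi> (\<phi> (\<phi> X)) = \<phi> (- X)"
      using \<phi>\<phi>[OF X(1)] X(2) by simp
    also have "\<phi> (- X) = - \<phi> X"
      using linear_on_space_diff[OF \<phi> V(1) subspace_0[OF V(1)] X(1)] \<phi>0 by simp
    finally have "\<eta> (\<phi> X) *\<^sub>R \<xi> = 0"
      using \<phi>\<phi>[OF \<phi>X] by simp
    moreover have "\<xi> \<noteq> 0"
      using \<eta>\<xi> \<eta>0 by auto
    ultimately show ?thesis
      using \<phi>X by (simp add: h_def form_kernel_def)
  qed
  \<comment> \<open>The abelian condition on \<open>br\<close> has two components: the one in
    \<open>h\<close> says that \<open>\<phi>\<close> is abelian for \<open>br'\<close>, the one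
    along \<open>\<xi>\<close> that \<open>\<sigma>\<close> is invariant.\<close>
  show "abelian_complex_structure h br' \<phi>"
    using \<phi> by (simp add: abelian_complex_structure_def \<phi>h hg \<phi>\<phi> abelian br'_def lin)
  show "invariant_form_on h \<phi> \<sigma>"
    by (simp add: invariant_form_on_def \<sigma>_def abelian)
  show "two_cocycle_on h br' \<sigma>"
    unfolding two_cocycle_on_def
  proof (intro conjI ballI)
    show "alternating_bilinear_on h UNIV \<sigma>"
      using br_lin[OF hg(1)]
      by (simp add: alternating_bilinear_on_def \<sigma>_def lin br_self hg \<eta>0 br_in \<eta>_add \<eta>_scale[OF _ \<xi>])
    fix X Y Z assume "X \<in> h" "Y \<in> h" "Z \<in> h"
    note g = this[THEN hg(1)]
    have skew: "br (br P Q) R = - br R (br P Q)" if "P \<in> g" "Q \<in> g" "R \<in> g" for P Q R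
      using that by (intro alternating_bilinear_on_skew[OF br V(1)] br_in)
    have in_g: "br (br X Y) Z \<in> g" "br (br Y Z) X \<in> g" "br (br Z X) Y \<in> g"
      using g by (simp_all add: br_in)
    have "\<sigma> (br' X Y) Z + \<sigma> (br' Y Z) X + \<sigma> (br' Z X) Y =
        \<eta> (br (br X Y) Z + br (br Y Z) X + br (br Z X) Y)"
      using g in_g V(1) by (simp add: \<sigma>_def br_br' \<eta>_add subspace_add)
    also have "br (br X Y) Z + br (br Y Z) X + br (br Z X) Y =
        - (br X (br Y Z) + br Y (br Z X) + br Z (br X Y))"
      using g by (simp add: skew algebra_simps)
    also have "\<dots> = 0"
      using jacobi[OF g] by simp
    finally show "\<sigma> (br' X Y) Z + \<sigma> (br' Y Z) X + \<sigma> (br' Z X) Y = 0"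
      by (simp add: \<eta>0)
  qed
  show "is_central_extension g br \<xi> h br' \<sigma>"
    unfolding is_central_extension_def lie_isomorphism_def
  proof (intro conjI ballI)
    show "linear_on_space (central_extension h) g (\<lambda>(t, X). t *\<^sub>R \<xi> + X)"
      using V(1) \<xi> hg(1)
      by (auto simp: lin central_extension_def subspace_add subspace_scale algebra_simps)
    show "bij_betw (\<lambda>(t, X). t *\<^sub>R \<xi> + X) (central_extension h) g"
    \<comment> \<open>The inverse is the decomposition of a vector along \<open>\<xi>\<close> and
      the kernel of \<open>\<eta>\<close>.\<close>
    proof (rule bij_betw_byWitness[where f' = "\<lambda>X. (\<eta> X, X - \<eta> X *\<^sub>R \<xi>)"])
      show "\<forall>a\<in>central_extension h.
          (\<lambda>X. (\<eta> X, X - \<eta> X *\<^sub>R \<xi>)) (case a of (t, X) \<Rightarrow> t *\<^sub>R \<xi> + X) = a"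
        using V(1) \<xi> by (auto simp: central_extension_def hg \<eta>_add \<eta>_scale[OF \<xi> \<xi>] \<eta>\<xi> subspace_scale)
      show "(\<lambda>(t, X). t *\<^sub>R \<xi> + X) ` central_extension h \<subseteq> g"
        using V(1) \<xi> by (auto simp: central_extension_def hg subspace_add subspace_scale)
      show "(\<lambda>X. (\<eta> X, X - \<eta> X *\<^sub>R \<xi>)) ` g \<subseteq> central_extension h"
        using split by (auto simp: central_extension_def)
    qed auto
    fix x y assume "x \<in> central_extension h" "y \<in> central_extension h"
    then obtain s X t Y where x: "x = (s, X)" "X \<in> g" and y: "y = (t, Y)" "Y \<in> g"
      using hg(1) by (cases x, cases y) (auto simp: central_extension_def)
    have "br (s *\<^sub>R \<xi> + X) (t *\<^sub>R \<xi> + Y) = br (s *\<^sub>R \<xi>) (t *\<^sub>R \<xi> + Y) + br X (t *\<^sub>R \<xi> + Y)"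
      using br_lin(2)[of "t *\<^sub>R \<xi> + Y"] x y \<xi> V(1) by (simp add: lin subspace_add subspace_scale)
    also have "br (s *\<^sub>R \<xi>) (t *\<^sub>R \<xi> + Y) = s *\<^sub>R br \<xi> (t *\<^sub>R \<xi> + Y)"
      using br_lin(2)[of "t *\<^sub>R \<xi> + Y"] y \<xi> V(1) by (simp add: lin subspace_add subspace_scale)
    also have "\<dots> = 0"
      using y \<xi> V(1) by (simp add: \<xi>_br subspace_add subspace_scale)
    also have "br X (t *\<^sub>R \<xi> + Y) = t *\<^sub>R br X \<xi> + br X Y"
      using br_lin(1)[OF x(2)] y \<xi> V(1) by (simp add: lin subspace_scale)
    finally show "(case central_extension_bracket \<sigma> br' x y of (t, X) \<Rightarrow> t *\<^sub>R \<xi> + X) =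
        br (case x of (t, X) \<Rightarrow> t *\<^sub>R \<xi> + X) (case y of (t, X) \<Rightarrow> t *\<^sub>R \<xi> + X)"
      using x y by (simp add: central_extension_bracket_def \<sigma>_def br'_def br_\<xi>)
  qed
qed

section \<open>From an invariant cocycle to an abelian almost contact structure\<close>

lemma lie_algebra_on_central_extension:
  fixes V :: "'a::real_vector set"
  assumes lie: "lie_algebra_on V br" and \<sigma>: "two_cocycle_on V br \<sigma>"
  shows "lie_algebra_on (central_extension V) (central_extension_bracket \<sigma> br)"
proof -
  from lie obtain B where V: "subspace V" "finite B" "V \<subseteq> span B"
    and br: "alternating_bilinear_on V V br"
    and jacobi: "\<And>X Y Z. X \<in> V \<Longrightarrow> Y \<in> V \<Longrightarrow> Z \<in> V \<Longrightarrow> br X (br Y Z) + br Y (br Z X) + br Z (br X Y) = 0"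
    unfolding lie_algebra_on_def by (elim conjE exE) (rule, simp_all)
  have alt: "alternating_bilinear_on V UNIV \<sigma>"
    and cocycle: "\<And>X Y Z. X \<in> V \<Longrightarrow> Y \<in> V \<Longrightarrow> Z \<in> V \<Longrightarrow> \<sigma> (br X Y) Z + \<sigma> (br Y Z) X + \<sigma> (br Z X) Y = 0"
    using \<sigma> by (auto simp: two_cocycle_on_def)
  have br_in: "br X Y \<in> V" if "X \<in> V" "Y \<in> V" for X Y
    using br that by (simp add: alternating_bilinear_on_def linear_on_space_def)
  have skew: "\<sigma> P (br Q R) = - \<sigma> (br Q R) P" if "P \<in> V" "Q \<in> V" "R \<in> V" for P Q R
    using that by (intro alternating_bilinear_on_skew[OF alt V(1)] br_in)
  \<comment> \<open>This is the \<open>\<xi>\<close>-component of the Jacobi identity of the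
    extension, where the inner bracket is the second argument; the other component is the Jacobi
    identity of \<open>V\<close>.\<close>
  have cocycle': "\<sigma> X (br Y Z) + \<sigma> Y (br Z X) + \<sigma> Z (br X Y) = 0"
    if "X \<in> V" "Y \<in> V" "Z \<in> V" for X Y Z
    using cocycle[OF that] that by (simp add: skew)
  show ?thesis
    unfolding lie_algebra_on_def
  proof (intro conjI ballI)
    show "subspace (central_extension V)"
      using V(1) by (auto simp: central_extension_def subspace_def zero_prod_def)
    show "\<exists>B. finite B \<and> central_extension V \<subseteq> span B"
      by (rule central_extension_finite_span[OF V])
    show "alternating_bilinear_on (central_extension V) (central_extension V) (central_extension_bracket \<sigma> br)"
      using br alt
      by (auto simp: alternating_bilinear_on_def linear_on_space_def central_extension_def
          central_extension_bracket_def zero_prod_def)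
    fix x y z assume "x \<in> central_extension V" "y \<in> central_extension V" "z \<in> central_extension V"
    then have "snd x \<in> V" "snd y \<in> V" "snd z \<in> V"
      by (auto simp: central_extension_def)
    then show "central_extension_bracket \<sigma> br x (central_extension_bracket \<sigma> br y z) +
        central_extension_bracket \<sigma> br y (central_extension_bracket \<sigma> br z x) +
        central_extension_bracket \<sigma> br z (central_extension_bracket \<sigma> br x y) = 0"
      by (simp add: central_extension_bracket_def zero_prod_def jacobi cocycle')
  qed
qed

lemma abelian_almost_contact_central_extension:
  fixes h :: "'a::real_vector set"
  assumes lie: "lie_algebra_on h br" and J: "abelian_complex_structure h br J"
    and \<sigma>: "two_cocycle_on h br \<sigma>" and inv: "invariant_form_on h J \<sigma>"
  defines "g \<equiv> central_extension h" and "br' \<equiv> central_extension_bracket \<sigma> br"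
  shows "abelian_almost_contact g br' (ext_phi J) ext_xi ext_eta" "ext_xi \<in> lie_center g br'"
    "contact_form g br' ext_eta \<longleftrightarrow> maximal_rank_on h \<sigma>"
proof -
  from lie obtain B where h: "subspace h" "finite B" "h \<subseteq> span B"
    and br: "alternating_bilinear_on h h br"
    unfolding lie_algebra_on_def by (elim conjE exE)
  have J_lin: "linear_on_space h h J" and JJ: "\<And>X. X \<in> h \<Longrightarrow> J (J X) = - X"
    and J_br: "\<And>X Y. X \<in> h \<Longrightarrow> Y \<in> h \<Longrightarrow> br (J X) (J Y) = br X Y"
    using J by (auto simp: abelian_complex_structure_def)
  have \<sigma>_alt: "alternating_bilinear_on h UNIV \<sigma>"
    using \<sigma> by (simp add: two_cocycle_on_def)
  have h0: "0 \<in> h"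
    by (rule subspace_0[OF h(1)])
  have J0: "J 0 = 0"
    by (rule linear_on_space_zero[OF J_lin h0])
  have zero: "br 0 X = 0" "\<sigma> 0 X = 0" if "X \<in> h" for X
    using br \<sigma>_alt that h0 linear_on_space_zero[where f = "\<lambda>Y. br Y X" and V = h and W = h]
      linear_on_space_zero[where f = "\<lambda>Y. \<sigma> Y X" and V = h and W = UNIV]
    by (auto simp: alternating_bilinear_on_def)
  have lie': "lie_algebra_on g br'"
    unfolding g_def br'_def by (rule lie_algebra_on_central_extension[OF lie \<sigma>])
  \<comment> \<open>\<open>J\<close> makes the dimension of \<open>h\<close> even, and
    \<open>\<xi>\<close> adds one.\<close>
  obtain n where n: "dim g = 2 * n + 1"
    using complex_structure_even_dim[OF h J_lin JJ] dim_central_extension[OF h]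
    by (auto simp: g_def elim!: evenE)
  have \<eta>: "linear_on_space g UNIV (ext_eta :: real \<times> 'a \<Rightarrow> real)"
    by (simp add: linear_on_space_def ext_eta_def)
  have \<phi>: "linear_on_space g g (ext_phi J)"
    using J_lin by (auto simp: linear_on_space_def g_def central_extension_def ext_phi_def)
  have \<xi>: "ext_xi \<in> g"
    using h0 by (simp add: g_def central_extension_def ext_xi_def)
  have "almost_contact_lie_algebra g br' (ext_phi J) ext_xi ext_eta"
    unfolding almost_contact_lie_algebra_def
    using lie' n \<phi> \<xi> \<eta>
    by (auto simp: g_def central_extension_def ext_phi_def ext_xi_def ext_eta_def JJ)
  then show "abelian_almost_contact g br' (ext_phi J) ext_xi ext_eta"
    using inv J_lin
    by (auto simp: abelian_almost_contact_def g_def br'_def central_extension_def form_kernel_def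
        central_extension_bracket_def ext_phi_def ext_xi_def ext_eta_def zero J0 J_br
        invariant_form_on_def linear_on_space_def)
  show center: "ext_xi \<in> lie_center g br'"
    using \<xi> by (auto simp: lie_center_def g_def br'_def central_extension_def
        central_extension_bracket_def ext_xi_def zero zero_prod_def)
  have "contact_form g br' ext_eta \<longleftrightarrow> maximal_rank_on (form_kernel g ext_eta) (\<lambda>x y. ext_eta (br' x y))"
    by (rule contact_form_iff_maximal_rank[OF lie' n \<eta> center]) (simp add: ext_eta_def ext_xi_def)
  \<comment> \<open>The kernel of \<open>ext_eta\<close> is \<open>{0} \<times> h\<close>, and the
    form on it is \<open>\<sigma>\<close> of the second components.\<close>
  also have "\<dots> \<longleftrightarrow> maximal_rank_on h \<sigma>"
    by (auto simp: maximal_rank_on_def form_kernel_def g_def br'_def central_extension_def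
        central_extension_bracket_def ext_eta_def zero_prod_def)
  finally show "contact_form g br' ext_eta \<longleftrightarrow> maximal_rank_on h \<sigma>" .
qed

theorem proposition3p6:
  fixes g :: "'a::real_vector set" and brg :: "'a \<Rightarrow> 'a \<Rightarrow> 'a"
    and \<phi> :: "'a \<Rightarrow> 'a" and \<xi> :: 'a and \<eta> :: "'a \<Rightarrow> real"
    and h :: "'b::real_vector set" and brh :: "'b \<Rightarrow> 'b \<Rightarrow> 'b"
    and J :: "'b \<Rightarrow> 'b" and \<sigma> :: "'b \<Rightarrow> 'b \<Rightarrow> real"
  shows
   "(abelian_almost_contact g brg \<phi> \<xi> \<eta> \<and> \<xi> \<in> lie_center g brg \<longrightarrow>
      (\<exists>br' \<sigma>'.
         lie_algebra_on (form_kernel g \<eta>) br' \<and>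
         abelian_complex_structure (form_kernel g \<eta>) br' \<phi> \<and>
         two_cocycle_on (form_kernel g \<eta>) br' \<sigma>' \<and>
         invariant_form_on (form_kernel g \<eta>) \<phi> \<sigma>' \<and>
         is_central_extension g brg \<xi> (form_kernel g \<eta>) br' \<sigma>' \<and>
         (\<forall>X\<in>form_kernel g \<eta>. \<forall>Y\<in>form_kernel g \<eta>. \<sigma>' X Y = - ext_d brg \<eta> X Y) \<and>
         (contact_form g brg \<eta> \<longleftrightarrow> maximal_rank_on (form_kernel g \<eta>) \<sigma>')))
    \<and>
    (lie_algebra_on h brh \<and> abelian_complex_structure h brh J \<and>
      two_cocycle_on h brh \<sigma> \<and> invariant_form_on h J \<sigma> \<longrightarrow>
      abelian_almost_contact (central_extension h) (central_extension_bracket \<sigma> brh)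
        (ext_phi J) ext_xi ext_eta \<and>
      ext_xi \<in> lie_center (central_extension h) (central_extension_bracket \<sigma> brh) \<and>
      (contact_form (central_extension h) (central_extension_bracket \<sigma> brh) ext_eta \<longleftrightarrow>
       maximal_rank_on h \<sigma>))"
proof (intro conjI impI)
  assume "abelian_almost_contact g brg \<phi> \<xi> \<eta> \<and> \<xi> \<in> lie_center g brg"
  then have g: "abelian_almost_contact g brg \<phi> \<xi> \<eta>" and center: "\<xi> \<in> lie_center g brg"
    by simp_all
  obtain n where "dim g = 2 * n + 1"
    using g unfolding abelian_almost_contact_def almost_contact_lie_algebra_def by (elim conjE exE)
  moreover have "lie_algebra_on g brg" "linear_on_space g UNIV \<eta>" "\<eta> \<xi> = 1"
    using g unfolding abelian_almost_contact_def almost_contact_lie_algebra_def by blast+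
  ultimately have "contact_form g brg \<eta> \<longleftrightarrow> maximal_rank_on (form_kernel g \<eta>) (\<lambda>X Y. \<eta> (brg X Y))"
    using center by (intro contact_form_iff_maximal_rank)
  then show "\<exists>br' \<sigma>'.
         lie_algebra_on (form_kernel g \<eta>) br' \<and>
         abelian_complex_structure (form_kernel g \<eta>) br' \<phi> \<and>
         two_cocycle_on (form_kernel g \<eta>) br' \<sigma>' \<and>
         invariant_form_on (form_kernel g \<eta>) \<phi> \<sigma>' \<and>
         is_central_extension g brg \<xi> (form_kernel g \<eta>) br' \<sigma>' \<and>
         (\<forall>X\<in>form_kernel g \<eta>. \<forall>Y\<in>form_kernel g \<eta>. \<sigma>' X Y = - ext_d brg \<eta> X Y) \<and>
         (contact_form g brg \<eta> \<longleftrightarrow> maximal_rank_on (form_kernel g \<eta>) \<sigma>')"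
    \<comment> \<open>The cocycle is the \<open>\<xi>\<close>-component of the bracket, which is
      \<open>- d\<eta>\<close> because \<open>ext_d\<close> carries a minus sign.\<close>
    by (intro exI[of _ "\<lambda>X Y. brg X Y - \<eta> (brg X Y) *\<^sub>R \<xi>"] exI[of _ "\<lambda>X Y. \<eta> (brg X Y)"] conjI
        abelian_almost_contact_kernel[OF g center]) (simp_all add: ext_d_def)
qed (use abelian_almost_contact_central_extension in blast)+

end
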